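(* Suppose $\varphi:\mathbb{R}^n\to\mathbb{C}^{M\times M}$ is such that there exist $C\in(0,\infty)$ and $\varepsilon\in(0,1]$ with $$|\varphi(x)|\le C(1+|x|)^{-n-\varepsilon}\quad\text{for every }x\in\mathbb{R}^n\setminus\{0\},$$ $$|\varphi(x+h)-\varphi(x)|\le\frac{C|h|^\varepsilon}{|x|^{n+\varepsilon}}\quad\text{for all }x\in\mathbb{R}^n\setminus\{0\},\ h\in\mathbb{R}^n,\ |h|<|x|/2,$$ and, in addition, $\int_{\mathbb{R}^n}\varphi(x)\,dx=I_{M\times M}$ (the $M\times M$ identity matrix). Set $\varphi_t(x):=t^{-n}\varphi(x/t)$ for $x\in\mathbb{R}^n$, $t>0$. Then for each $f\in\mathrm{VMO}(\mathbb{R}^n,\mathbb{C}^M)$, $$\varphi_t*f\longrightarrow f\ \text{ in }\mathrm{BMO}(\mathbb{R}^n,\mathbb{C}^M)\ \text{ as }t\to0^+.$$ As a consequence, if $\varphi\in C^1(\mathbb{R}^n,\mathbb{C}^{M\times M})$ satisfies $\int_{\mathbb{R}^n}\varphi(x)\,dx=I_{M\times M}$ and there is $C\in(0,\infty)$ such that $$|\varphi(x)|+|(\nabla\varphi)(x)|\le C(1+|x|)^{-n-1}\quad\text{for every }x\in\mathbb{R}^n,$$ then for every $f\in\mathrm{BMO}(\mathbb{R}^n,\mathbb{C}^M)$ one has $$\varphi_t*f\to f\text{ in }\mathrm{BMO}(\mathbb{R}^n,\mathbb{C}^M)\text{ as }t\to0^+\iff f\in\mathrm{VMO}(\mathbb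{R}^n,\mathbb{C}^M).$$
   Context: $n,M\in\mathbb{N}$. $\mathrm{BMO}(\mathbb{R}^n,\mathbb{C}^M)$ is the space of $f\in L^1_{\rm loc}(\mathbb{R}^n,\mathbb{C}^M)$ with $\|f\|_{\mathrm{BMO}(\mathbb{R}^n,\mathbb{C}^M)}:=\sup_Q|Q|^{-1}\int_Q|f-f_Q|\,dx<\infty$, the supremum being over all cubes $Q\subset\mathbb{R}^n$ with sides parallel to the axes, where $f_Q:=|Q|^{-1}\int_Qf$. $\mathrm{VMO}(\mathbb{R}^n,\mathbb{C}^M)$ is the space of $f\in\mathrm{BMO}(\mathbb{R}^n,\mathbb{C}^M)$ with $\lim_{r\to0^+}\sup_{\ell(Q)\le r}|Q|^{-1}\int_Q|f-f_Q|\,dx=0$, where $\ell(Q)$ is the side-length of $Q$. Convergence in $\mathrm{BMO}$ means convergence in the seminorm $\|\cdot\|_{\mathrm{BMO}}$. Convolution of a matrix-valued function with a vector-valued one uses matrix-vector multiplication. *)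

theory Defs
  imports "HOL-Analysis.Analysis"
begin

definition locally_integrable :: "(real^'n \<Rightarrow> 'b::euclidean_space) \<Rightarrow> bool" where
  "locally_integrable f \<longleftrightarrow> (\<forall>K. compact K \<longrightarrow> f absolutely_integrable_on K)"

definition cube :: "real^'n \<Rightarrow> real \<Rightarrow> (real^'n) set" where
  "cube a l = cbox a (\<chi> i. a $ i + l)"

definition average :: "(real^'n \<Rightarrow> 'b::euclidean_space) \<Rightarrow> (real^'n) set \<Rightarrow> 'b" where
  "average f Q = (1 / measure lebesgue Q) *\<^sub>R (LINT x:Q|lebesgue. f x)"

definition mean_oscillation :: "(real^'n \<Rightarrow> 'b::euclidean_space) \<Rightarrow> (real^'n) set \<Rightarrow> real" where
  "mean_oscillation f Q = average (\<lambda>x. norm (f x - average f Q)) Q"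

text \<open>The suprema below are taken in \<^typ>\<open>ennreal\<close>, so that they may be infinite; the real-valued
  supremum would be unspecified on an unbounded family. Both are meaningful only for
  locally integrable \<open>f\<close>, since the Bochner integral of a non-integrable function is 0.\<close>

definition BMO_norm :: "(real^'n \<Rightarrow> complex^'m) \<Rightarrow> ennreal" where
  "BMO_norm f = (SUP (a, l) \<in> UNIV \<times> {0<..}. ennreal (mean_oscillation f (cube a l)))"

definition BMO :: "(real^'n \<Rightarrow> complex^'m) set" where
  "BMO = {f. locally_integrable f \<and> BMO_norm f < \<infinity>}"

definition VMO :: "(real^'n \<Rightarrow> complex^'m) set" where
  "VMO = {f \<in> BMO.
     ((\<lambda>r. SUP (a, l) \<in> UNIV \<times> {0<..r}. ennreal (mean_oscillation f (cube a l))) \<longlongrightarrow> 0)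
       (at_right 0)}"

text \<open>Membership in \<open>BMO\<close> is part of convergence: without it, a function that is not locally
  integrable could have \<open>BMO_norm\<close> zero.\<close>

definition tendsto_BMO ::
  "('t \<Rightarrow> real^'n \<Rightarrow> complex^'m) \<Rightarrow> (real^'n \<Rightarrow> complex^'m) \<Rightarrow> 't filter \<Rightarrow> bool" where
  "tendsto_BMO g f F \<longleftrightarrow>
     f \<in> BMO \<and> (\<forall>\<^sub>F t in F. g t \<in> BMO) \<and> ((\<lambda>t. BMO_norm (\<lambda>x. g t x - f x)) \<longlongrightarrow> 0) F"

definition convolution ::
  "(real^'n \<Rightarrow> complex^'m^'m) \<Rightarrow> (real^'n \<Rightarrow> complex^'m) \<Rightarrow> real^'n \<Rightarrow> complex^'m" where
  "convolution \<phi> f x = (LINT y|lebesgue. \<phi> (x - y) *v f y)"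

definition dilation :: "real \<Rightarrow> (real^'n \<Rightarrow> complex^'m^'m) \<Rightarrow> real^'n \<Rightarrow> complex^'m^'m" where
  "dilation t \<phi> x = (1 / t ^ CARD('n)) *\<^sub>R \<phi> ((1 / t) *\<^sub>R x)"

text \<open>The tuple of partial derivatives; meaningful where \<open>\<phi>\<close> is differentiable.\<close>

definition gradient :: "(real^'n \<Rightarrow> complex^'m^'m) \<Rightarrow> real^'n \<Rightarrow> (complex^'m^'m)^'n" where
  "gradient \<phi> x = (\<chi> j. frechet_derivative \<phi> (at x) (axis j 1))"

definition continuously_differentiable :: "(real^'n \<Rightarrow> complex^'m^'m) \<Rightarrow> bool" where
  "continuously_differentiable \<phi> \<longleftrightarrow>
     (\<forall>x. \<phi> differentiable (at x)) \<and> continuous_on UNIV (gradient \<phi>)"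

end

theory Submission
  imports Defs
begin

text \<open>Let \<open>\<omega>(r)\<close> be the supremum of the mean oscillations of \<open>f\<close> over cubes of side at most \<open>r\<close>. If \<open>P\<close> is
  a cube of side \<open>t\<close> and \<open>x \<in> P\<close>, then \<open>\<phi>\<^sub>t * f (x) - f\<^sub>P\<close> is the integral of
  \<open>\<phi>\<^sub>t (x - y) (f (y) - f\<^sub>P)\<close>. Splitting it over the dyadic enlargements \<open>2\<^sup>k P\<close> and telescoping the
  averages bounds its norm by a multiple of \<open>\<delta>(t) = \<Sum>k. 2 powr (- k \<epsilon>) (1 + k 2\<^sup>n) \<omega>(2\<^sup>k t)\<close>. This is a
  pointwise bound, since \<open>\<phi>\<close> is bounded off the origin. On cubes of side at most \<open>t\<close> it controls the
  oscillation of \<open>\<phi>\<^sub>t * f\<close>, and larger cubes are covered by cubes of side \<open>t\<close>, on which it controls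
  the average of \<open>|\<phi>\<^sub>t * f - f|\<close>. Hence the BMO norm of \<open>\<phi>\<^sub>t * f - f\<close> is at most a constant times \<open>\<delta>(t)\<close>,
  which tends to 0 by dominated convergence when \<open>\<omega>\<close> does. The smoothness of \<open>\<phi>\<close> enters only through
  measurability and the continuity of \<open>\<phi>\<^sub>t * f\<close>.

  Conversely, for smooth \<open>\<phi>\<close> the difference \<open>\<phi>\<^sub>t (x - y) - \<phi>\<^sub>t (a - y)\<close> has the same decay with the
  additional factor \<open>|x - a| / t\<close>. So \<open>\<phi>\<^sub>t * f\<close> is locally Lipschitz with uniform constant, it has small
  oscillation on small cubes, and a limit in BMO of such functions is in VMO.\<close>

subsection \<open>Averages and mean oscillation over cubes\<close>

lemma mem_cube: "x \<in> cube a l \<longleftrightarrow> (\<forall>i. a $ i \<le> x $ i \<and> x $ i \<le> a $ i + l)"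
  by (simp add: cube_def mem_box_cart)

lemma compact_cube [simp]: "compact (cube a l)"
  by (simp add: cube_def compact_cbox)

lemma lmeasurable_cube [simp]: "cube a l \<in> lmeasurable"
  by (simp add: cube_def)

lemma sets_cube [measurable, simp]: "cube a l \<in> sets lebesgue"
  using lmeasurable_cube by (rule fmeasurableD)

lemma measure_cube [simp]:
  fixes a :: "real^'n"
  assumes "0 \<le> l"
  shows "measure lebesgue (cube a l) = l ^ CARD('n)"
proof -
  have "a \<in> cube a l" using assms by (simp add: mem_cube)
  then have "cbox a (\<chi> i. a $ i + l) \<noteq> {}" by (auto simp: cube_def)
  then show ?thesis by (simp add: cube_def content_cbox_cart)
qed

lemma dist_cube_le:
  fixes x y :: "real^'n"
  assumes "x \<in> cube a l" "y \<in> cube a l"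
  shows "norm (x - y) \<le> real CARD('n) * l"
proof -
  have "norm (x - y) \<le> (\<Sum>i\<in>UNIV. \<bar>(x - y) $ i\<bar>)" by (rule norm_le_l1_cart)
  also have "\<dots> \<le> (\<Sum>i\<in>(UNIV :: 'n set). l)"
  proof (rule sum_mono)
    fix i
    show "\<bar>(x - y) $ i\<bar> \<le> l"
      using assms unfolding mem_cube by (smt (verit) vector_minus_component)
  qed
  finally show ?thesis by simp
qed

lemma average_const [simp]: "0 < l \<Longrightarrow> average (\<lambda>_. c) (cube a l) = c"
  using set_integral_const[of "cube a l" lebesgue c] fmeasurableD2[OF lmeasurable_cube[of a l]]
  by (simp add: average_def)

lemma average_add:
  assumes "f absolutely_integrable_on Q" "g absolutely_integrable_on Q"
  shows "average (\<lambda>x. f x + g x) Q = average f Q + average g Q"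
  by (simp only: average_def set_integral_add[OF assms] scaleR_add_right)

lemma average_diff:
  assumes "f absolutely_integrable_on Q" "g absolutely_integrable_on Q"
  shows "average (\<lambda>x. f x - g x) Q = average f Q - average g Q"
  by (simp only: average_def set_integral_diff[OF assms] scaleR_diff_right)

lemma average_mono:
  fixes f g :: "real^'n \<Rightarrow> real"
  assumes "f absolutely_integrable_on Q" "g absolutely_integrable_on Q" "\<And>x. x \<in> Q \<Longrightarrow> f x \<le> g x"
  shows "average f Q \<le> average g Q"
  by (simp add: average_def mult_left_mono set_integral_mono[OF assms] divide_right_mono)

lemma average_nonneg:
  fixes f :: "real^'n \<Rightarrow> real"
  assumes "\<And>x. x \<in> Q \<Longrightarrow> 0 \<le> f x"
  shows "0 \<le> average f Q"
proof -
  have "0 \<le> (LINT x:Q|lebesgue. f x)"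
    unfolding set_lebesgue_integral_def
    by (rule Bochner_Integration.integral_nonneg) (auto simp: indicator_def assms)
  then show ?thesis by (simp add: average_def)
qed

lemma norm_average_le:
  assumes "f absolutely_integrable_on Q"
  shows "norm (average f Q) \<le> average (\<lambda>x. norm (f x)) Q"
  using set_integral_norm_bound[OF assms]
  by (simp add: average_def divide_right_mono)

lemma mean_oscillation_nonneg: "0 \<le> mean_oscillation f Q"
  unfolding mean_oscillation_def by (rule average_nonneg) simp

lemma absolutely_integrable_const_cube [simp]:
  "(\<lambda>_. c) absolutely_integrable_on cube a l"
  unfolding set_integrable_def using fmeasurableD2[OF lmeasurable_cube[of a l]]
  by (intro integrable_scaleR_left integrable_real_indicator) (auto simp: less_top)

lemma absolutely_integrable_cube_norm_diff:
  assumes "f absolutely_integrable_on cube a l"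
  shows "(\<lambda>x. norm (f x - c)) absolutely_integrable_on cube a l"
  by (intro set_integrable_norm set_integral_diff(1) assms absolutely_integrable_const_cube)

lemma locally_integrable_cube:
  "locally_integrable f \<Longrightarrow> f absolutely_integrable_on cube a l"
  by (simp add: locally_integrable_def)

text \<open>By the triangle inequality, \<open>|f_Q - c|\<close> is itself at most the average of
  \<open>|f - c|\<close>, so exchanging the mean for another constant costs a factor of 2. Later
  estimates can thus compare with whichever constant is convenient.\<close>

lemma mean_oscillation_le:
  assumes f: "f absolutely_integrable_on cube a l" and "0 < l"
  shows "mean_oscillation f (cube a l) \<le> 2 * average (\<lambda>x. norm (f x - c)) (cube a l)"
proof -
  let ?Q = "cube a l"
  have "average f ?Q - c = average (\<lambda>x. f x - c) ?Q"
    using \<open>0 < l\<close> by (simp add: average_diff[OF f])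
  then have d: "norm (c - average f ?Q) \<le> average (\<lambda>x. norm (f x - c)) ?Q"
    using norm_average_le[OF set_integral_diff(1)[OF f absolutely_integrable_const_cube]]
    by (metis norm_minus_commute)
  have "mean_oscillation f ?Q \<le> average (\<lambda>x. norm (f x - c) + norm (c - average f ?Q)) ?Q"
    unfolding mean_oscillation_def
  proof (rule average_mono)
    show "norm (f x - average f ?Q) \<le> norm (f x - c) + norm (c - average f ?Q)" for x
      using norm_triangle_ineq[of "f x - c" "c - average f ?Q"] by simp
  qed (intro set_integral_add(1) absolutely_integrable_cube_norm_diff f absolutely_integrable_const_cube)+
  also have "\<dots> = average (\<lambda>x. norm (f x - c)) ?Q + norm (c - average f ?Q)"
    using \<open>0 < l\<close> by (subst average_add)
      (auto intro: absolutely_integrable_cube_norm_diff f)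
  finally show ?thesis using d by simp
qed

lemma mean_oscillation_add_le:
  assumes f: "f absolutely_integrable_on cube a l" and g: "g absolutely_integrable_on cube a l"
  shows "mean_oscillation (\<lambda>x. f x + g x) (cube a l)
    \<le> mean_oscillation f (cube a l) + mean_oscillation g (cube a l)"
  unfolding mean_oscillation_def average_add[OF f g]
  unfolding average_add[OF absolutely_integrable_cube_norm_diff[OF f]
      absolutely_integrable_cube_norm_diff[OF g], symmetric]
proof (rule average_mono)
  show "norm (f x + g x - (average f (cube a l) + average g (cube a l)))
    \<le> norm (f x - average f (cube a l)) + norm (g x - average g (cube a l))" for x
    by (simp add: norm_diff_triangle_ineq)
qed (intro set_integral_add(1) absolutely_integrable_cube_norm_diff f g)+

lemma mean_oscillation_diff_le:
  assumes f: "f absolutely_integrable_on cube a l" and g: "g absolutely_integrable_on cube a l"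
  shows "mean_oscillation (\<lambda>x. f x - g x) (cube a l)
    \<le> mean_oscillation f (cube a l) + mean_oscillation g (cube a l)"
  unfolding mean_oscillation_def average_diff[OF f g]
  unfolding average_add[OF absolutely_integrable_cube_norm_diff[OF f]
      absolutely_integrable_cube_norm_diff[OF g], symmetric]
proof (rule average_mono)
  show "norm (f x - g x - (average f (cube a l) - average g (cube a l)))
    \<le> norm (f x - average f (cube a l)) + norm (g x - average g (cube a l))" for x
    by norm
qed (intro set_integral_add(1) absolutely_integrable_cube_norm_diff set_integral_diff(1) f g)+

text \<open>Enlarging the domain of integration of \<open>|f - c|\<close> from the small cube to the
  large one and renormalising costs the ratio of the volumes. Here \<open>c\<close> is the average
  over the large cube.\<close>

lemma norm_average_diff_le_mean_oscillation:
  fixes f :: "real^'n \<Rightarrow> 'b::euclidean_space"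
  assumes f: "f absolutely_integrable_on cube b m" and sub: "cube a l \<subseteq> cube b m"
    and "0 < l" "0 < m"
  shows "norm (average f (cube a l) - average f (cube b m))
    \<le> (m / l) ^ CARD('n) * mean_oscillation f (cube b m)"
proof -
  let ?c = "average f (cube b m)"
  let ?h = "\<lambda>x. norm (f x - ?c)"
  have fa: "f absolutely_integrable_on cube a l"
    by (rule set_integrable_subset[OF f _ sub]) simp
  have "average f (cube a l) - ?c = average (\<lambda>x. f x - ?c) (cube a l)"
    using \<open>0 < l\<close> by (simp add: average_diff[OF fa])
  then have "norm (average f (cube a l) - ?c) \<le> average ?h (cube a l)"
    using norm_average_le[OF set_integral_diff(1)[OF fa absolutely_integrable_const_cube]] by metis
  also have "\<dots> \<le> 1 / l ^ CARD('n) * (LINT x:cube b m|lebesgue. ?h x)"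
  proof -
    have "(LINT x:cube a l|lebesgue. ?h x) \<le> (LINT x:cube b m|lebesgue. ?h x)"
      using absolutely_integrable_cube_norm_diff[OF fa] absolutely_integrable_cube_norm_diff[OF f] sub
      unfolding set_lebesgue_integral_def set_integrable_def
      by (intro integral_mono) (auto simp: indicator_def)
    then show ?thesis using \<open>0 < l\<close> by (simp add: average_def divide_right_mono)
  qed
  also have "\<dots> = (m / l) ^ CARD('n) * mean_oscillation f (cube b m)"
    using \<open>0 < m\<close> by (simp add: mean_oscillation_def average_def power_divide)
  finally show ?thesis .
qed

subsection \<open>Decaying kernels and dyadic enlargements\<close>

text \<open>The cube concentric with \<open>cube a t\<close> of side \<open>2\<^sup>k t\<close>.\<close>

definition dyadic_cube :: "real^'n \<Rightarrow> real \<Rightarrow> nat \<Rightarrow> (real^'n) set" where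
  "dyadic_cube a t k = cube (\<chi> i. a $ i - (2 ^ k - 1) / 2 * t) (2 ^ k * t)"

lemma mem_dyadic_cube:
  "y \<in> dyadic_cube a t k \<longleftrightarrow>
    (\<forall>i. a $ i - (2 ^ k - 1) / 2 * t \<le> y $ i \<and> y $ i \<le> a $ i + t + (2 ^ k - 1) / 2 * t)"
  by (simp add: dyadic_cube_def mem_cube field_simps)

lemma dyadic_cube_0 [simp]: "dyadic_cube a t 0 = cube a t"
  by (simp add: dyadic_cube_def vec_eq_iff)

lemma dyadic_cube_Suc_subset:
  assumes "0 < t"
  shows "dyadic_cube a t k \<subseteq> dyadic_cube a t (Suc k)"
proof
  fix y assume y: "y \<in> dyadic_cube a t k"
  have "(2 ^ k - 1) / 2 * t \<le> (2 ^ Suc k - 1) / 2 * t"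
    using assms by (intro mult_right_mono divide_right_mono) auto
  then show "y \<in> dyadic_cube a t (Suc k)"
    using y unfolding mem_dyadic_cube by (smt (verit))
qed

lemma ex_dyadic_cube:
  assumes "0 < t"
  shows "\<exists>k. y \<in> dyadic_cube a t k"
proof -
  \<comment> \<open>The k-th cube extends beyond \<open>cube a t\<close> by the margin
    \<open>(2^k - 1) / 2 * t\<close> in each direction, and k is chosen so that this margin exceeds
    \<open>|y - a|\<close>.\<close>
  obtain k where k: "1 + 2 * norm (y - a) / t < 2 ^ k"
    using real_arch_pow[of 2 "1 + 2 * norm (y - a) / t"] by auto
  then have "norm (y - a) \<le> (2 ^ k - 1) / 2 * t" using assms by (simp add: field_simps)
  then have "\<bar>y $ i - a $ i\<bar> \<le> (2 ^ k - 1) / 2 * t" for i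
    using component_le_norm_cart[of "y - a" i] by simp
  then have "y \<in> dyadic_cube a t k"
    unfolding mem_dyadic_cube using assms by (smt (verit))
  then show ?thesis ..
qed

text \<open>A point outside the k-th cube leaves it in some coordinate, and in that coordinate it
  differs from \<open>x\<close> by at least the margin \<open>(2^k - 1) / 2 * t\<close>.\<close>

lemma outside_dyadic_cube:
  assumes "0 < t" "x \<in> cube a t" "y \<notin> dyadic_cube a t k"
  shows "2 ^ k / 2 \<le> 1 + norm (x - y) / t"
proof -
  obtain i where "\<not> (a $ i - (2 ^ k - 1) / 2 * t \<le> y $ i \<and> y $ i \<le> a $ i + t + (2 ^ k - 1) / 2 * t)"
    using assms(3) unfolding mem_dyadic_cube by auto
  moreover have "a $ i \<le> x $ i \<and> x $ i \<le> a $ i + t"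
    using assms(2) by (simp add: mem_cube)
  moreover have "\<bar>x $ i - y $ i\<bar> \<le> norm (x - y)"
    using component_le_norm_cart[of "x - y" i] by simp
  ultimately have "(2 ^ k - 1) / 2 * t \<le> norm (x - y)" by linarith
  then have "(2 ^ k - 1) / 2 \<le> norm (x - y) / t"
    using assms(1) by (simp add: field_simps)
  then show ?thesis by (simp add: field_simps)
qed

text \<open>The term of the first dyadic cube containing \<open>y\<close> alone dominates the
  kernel. Summing over full cubes instead of annuli only adds nonnegative terms.\<close>

lemma kernel_le_dyadic_sum:
  assumes "0 < t" "x \<in> cube a t" "0 \<le> s"
  shows "ennreal ((1 + norm (x - y) / t) powr (- s))
    \<le> ennreal (4 powr s) * (\<Sum>k. ennreal ((2 ^ k) powr (- s)) * indicator (dyadic_cube a t k) y)"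
proof -
  define k where "k = (LEAST k. y \<in> dyadic_cube a t k)"
  have k: "y \<in> dyadic_cube a t k"
    unfolding k_def using ex_dyadic_cube[OF \<open>0 < t\<close>] by (rule LeastI_ex)
  \<comment> \<open>By minimality \<open>y\<close> lies outside the cube of index k - 1, where the
    lower bound is \<open>2^(k-1) / 2\<close>; this is the source of the constant 4. For k = 0 the
    bound is trivial.\<close>
  have "2 ^ k / 4 \<le> 1 + norm (x - y) / t"
  proof (cases k)
    case 0
    then show ?thesis using assms(1) by (simp add: add_increasing2)
  next
    case (Suc j)
    then have "y \<notin> dyadic_cube a t j"
      using not_less_Least[of j "\<lambda>k. y \<in> dyadic_cube a t k"] by (simp add: k_def)
    from outside_dyadic_cube[OF assms(1,2) this] show ?thesis using Suc by simp
  qed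
  then have "(1 + norm (x - y) / t) powr (- s) \<le> (2 ^ k / 4) powr (- s)"
    using assms(3) by (intro powr_mono2') auto
  also have "\<dots> = 4 powr s * (2 ^ k) powr (- s)"
    by (simp add: powr_divide powr_minus field_simps)
  finally have "ennreal ((1 + norm (x - y) / t) powr (- s)) \<le> ennreal (4 powr s) * ennreal ((2 ^ k) powr (- s))"
    by (simp flip: ennreal_mult)
  also have "ennreal ((2 ^ k) powr (- s)) = (\<Sum>j\<in>{k}. ennreal ((2 ^ j) powr (- s)) * indicator (dyadic_cube a t j) y)"
    using k by simp
  also have "\<dots> \<le> (\<Sum>j. ennreal ((2 ^ j) powr (- s)) * indicator (dyadic_cube a t j) y)"
    by (rule sum_le_suminf) auto
  finally show ?thesis by (simp add: mult_left_mono)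
qed

text \<open>The function is the pointwise limit of its truncations to growing balls, each of which
  is integrable.\<close>

lemma locally_integrable_measurable:
  fixes f :: "real^'n \<Rightarrow> 'b::euclidean_space"
  assumes "locally_integrable f"
  shows "f \<in> borel_measurable lebesgue"
proof (rule borel_measurable_LIMSEQ_metric)
  show "(\<lambda>x. indicator (cball 0 (real k)) x *\<^sub>R f x) \<in> borel_measurable lebesgue" for k
    using assms unfolding locally_integrable_def set_integrable_def
    by (meson borel_measurable_integrable compact_cball)
  fix x :: "real^'n"
  obtain N where N: "norm x \<le> real N" using real_arch_simple by blast
  have "indicator (cball 0 (real k)) x *\<^sub>R f x = f x" if "k \<ge> N" for k
    using N that by (auto simp: indicator_def)
  then show "(\<lambda>k. indicator (cball 0 (real k)) x *\<^sub>R f x) \<longlonglongrightarrow> f x"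
    by (intro tendsto_eventually eventually_sequentiallyI[of N]) auto
qed

text \<open>The dyadic bound for the kernel is integrated term by term. Working with nonnegative
  extended integrals avoids any prior knowledge of integrability or summability.\<close>

lemma nn_integral_kernel_le:
  fixes g :: "real^'n \<Rightarrow> real"
  assumes "0 < t" "x \<in> cube a t" "0 \<le> \<epsilon>"
    and g: "locally_integrable g" "\<And>y. 0 \<le> g y"
  shows "(\<integral>\<^sup>+ y. ennreal ((1 + norm (x - y) / t) powr (- real CARD('n) - \<epsilon>) / t ^ CARD('n) * g y) \<partial>lebesgue)
    \<le> ennreal (4 powr (real CARD('n) + \<epsilon>)) *
      (\<Sum>k. ennreal ((2 powr (- \<epsilon>)) ^ k * average g (dyadic_cube a t k)))"
proof -
  note [measurable] = locally_integrable_measurable[OF g(1)]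
  let ?n = "CARD('n)"
  let ?s = "real ?n + \<epsilon>"
  let ?D = "dyadic_cube a t"
  have [measurable]: "?D k \<in> sets lebesgue" for k by (simp add: dyadic_cube_def)
  have "(\<integral>\<^sup>+ y. ennreal ((1 + norm (x - y) / t) powr (- real CARD('n) - \<epsilon>) / t ^ CARD('n) * g y) \<partial>lebesgue)
    \<le> (\<integral>\<^sup>+ y. ennreal (4 powr ?s) *
       (\<Sum>k. ennreal ((2 ^ k) powr (- ?s) / t ^ ?n) * (ennreal (g y) * indicator (?D k) y)) \<partial>lebesgue)"
  proof (rule nn_integral_mono)
    fix y
    have "ennreal ((1 + norm (x - y) / t) powr (- real CARD('n) - \<epsilon>) / t ^ CARD('n) * g y)
      = ennreal (1 / t ^ ?n) * ennreal (g y) * ennreal ((1 + norm (x - y) / t) powr (- ?s))"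
      using \<open>0 < t\<close> g(2) by (simp flip: ennreal_mult add: mult.commute mult.left_commute)
    also have "\<dots> \<le> ennreal (1 / t ^ ?n) * ennreal (g y) *
       (ennreal (4 powr ?s) * (\<Sum>k. ennreal ((2 ^ k) powr (- ?s)) * indicator (?D k) y))"
      using assms by (intro mult_left_mono kernel_le_dyadic_sum) auto
    also have "\<dots> = ennreal (4 powr ?s) *
       (\<Sum>k. ennreal (1 / t ^ ?n) * ennreal (g y) * (ennreal ((2 ^ k) powr (- ?s)) * indicator (?D k) y))"
      by (simp only: ennreal_suminf_cmult) (simp only: ac_simps)
    also have "\<dots> = ennreal (4 powr ?s) *
       (\<Sum>k. ennreal ((2 ^ k) powr (- ?s) / t ^ ?n) * (ennreal (g y) * indicator (?D k) y))"
    proof -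
      have "ennreal ((2 ^ k) powr (- ?s) / t ^ ?n) = ennreal ((2 ^ k) powr (- ?s)) * ennreal (1 / t ^ ?n)" for k :: nat
        using \<open>0 < t\<close> by (simp flip: ennreal_mult)
      then show ?thesis by (simp only: ac_simps)
    qed
    finally show "ennreal ((1 + norm (x - y) / t) powr (- real CARD('n) - \<epsilon>) / t ^ CARD('n) * g y) \<le> \<dots>" .
  qed
  also have "\<dots> = ennreal (4 powr ?s) *
      (\<Sum>k. ennreal ((2 ^ k) powr (- ?s) / t ^ ?n) * (\<integral>\<^sup>+ y. ennreal (g y) * indicator (?D k) y \<partial>lebesgue))"
    by (simp add: nn_integral_cmult nn_integral_suminf)
  also have "\<dots> = ennreal (4 powr ?s) *
      (\<Sum>k. ennreal ((2 powr (- \<epsilon>)) ^ k * average g (?D k)))"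
  proof -
    have "ennreal ((2 ^ k) powr (- ?s) / t ^ ?n) * (\<integral>\<^sup>+ y. ennreal (g y) * indicator (?D k) y \<partial>lebesgue)
      = ennreal ((2 powr (- \<epsilon>)) ^ k * average g (?D k))" for k
    proof -
      have i: "set_integrable lebesgue (?D k) g"
        using locally_integrable_cube[OF g(1)] by (simp add: dyadic_cube_def)
      have "(\<integral>\<^sup>+ y. ennreal (g y) * indicator (?D k) y \<partial>lebesgue)
        = (\<integral>\<^sup>+ y. ennreal (indicator (?D k) y *\<^sub>R g y) \<partial>lebesgue)"
        by (intro nn_integral_cong) (simp add: indicator_def)
      also have "\<dots> = ennreal (LINT y:?D k|lebesgue. g y)"
        using i g(2) unfolding set_integrable_def set_lebesgue_integral_def
        by (intro nn_integral_eq_integral) auto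
      also have "(LINT y:?D k|lebesgue. g y) = (2 ^ k * t) ^ ?n * average g (?D k)"
        using \<open>0 < t\<close> by (simp add: average_def dyadic_cube_def)
      finally have "ennreal ((2 ^ k) powr (- ?s) / t ^ ?n) * (\<integral>\<^sup>+ y. ennreal (g y) * indicator (?D k) y \<partial>lebesgue)
        = ennreal ((2 ^ k) powr (- ?s) / t ^ ?n * ((2 ^ k * t) ^ ?n * average g (?D k)))"
        using \<open>0 < t\<close> average_nonneg[of "?D k" g] g(2) by (simp flip: ennreal_mult)
      also have "(2 ^ k) powr (- ?s) / t ^ ?n * ((2 ^ k * t) ^ ?n * average g (?D k))
         = (2 powr (- \<epsilon>)) ^ k * average g (?D k)"
      proof -
        \<comment> \<open>The volume \<open>(2^k t)^n\<close> of the k-th cube cancels the part of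
          the decay of order n; only the gain of order \<open>\<epsilon>\<close> survives.\<close>
        have "(2 ^ k) powr (- ?s) * (2 ^ k) ^ ?n = (2 powr (- \<epsilon>)) ^ k"
          by (simp flip: powr_realpow powr_add add: powr_powr algebra_simps)
        then show ?thesis using \<open>0 < t\<close> by (simp add: power_mult_distrib)
      qed
      finally show ?thesis .
    qed
    then show ?thesis by simp
  qed
  finally show ?thesis .
qed

text \<open>The averages are telescoped from \<open>cube a t\<close> up to the k-th cube.
  Consecutive sides have ratio 2, so each of the k steps costs \<open>2^n\<close> times an
  oscillation, and monotonicity replaces all of these by \<open>w k\<close>. The summand 1 is the
  oscillation over the k-th cube itself.\<close>

lemma average_diff_dyadic_le:
  fixes f :: "real^'n \<Rightarrow> 'b::euclidean_space"
  assumes f: "locally_integrable f" and "0 < t"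
    and w: "\<And>k. mean_oscillation f (dyadic_cube a t k) \<le> w k" "mono w"
  shows "average (\<lambda>y. norm (f y - average f (cube a t))) (dyadic_cube a t k)
    \<le> (1 + real k * 2 ^ CARD('n)) * w k"
proof -
  let ?D = "dyadic_cube a t"
  have w0: "0 \<le> w k" for k
    using mean_oscillation_nonneg w(1) by (rule order_trans)
  have fi: "f absolutely_integrable_on ?D k" for k
    by (simp add: dyadic_cube_def locally_integrable_cube[OF f])
  have step: "norm (average f (?D k) - average f (?D (Suc k))) \<le> 2 ^ CARD('n) * w (Suc k)" for k
  proof -
    have "norm (average f (?D k) - average f (?D (Suc k)))
      \<le> (2 ^ Suc k * t / (2 ^ k * t)) ^ CARD('n) * mean_oscillation f (?D (Suc k))"
      using fi[of "Suc k"] dyadic_cube_Suc_subset[OF \<open>0 < t\<close>, of a k] \<open>0 < t\<close>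
      unfolding dyadic_cube_def by (intro norm_average_diff_le_mean_oscillation) auto
    also have "2 ^ Suc k * t / (2 ^ k * t) = 2" using \<open>0 < t\<close> by simp
    finally show ?thesis using w(1)[of "Suc k"]
      by (meson mult_left_mono order_trans zero_le_numeral zero_le_power)
  qed
  have avg: "norm (average f (cube a t) - average f (?D k)) \<le> real k * 2 ^ CARD('n) * w k"
  proof (induction k)
    case (Suc k)
    have "norm (average f (cube a t) - average f (?D (Suc k)))
      \<le> norm (average f (cube a t) - average f (?D k)) + norm (average f (?D k) - average f (?D (Suc k)))"
      by norm
    also have "\<dots> \<le> real k * 2 ^ CARD('n) * w (Suc k) + 2 ^ CARD('n) * w (Suc k)"
      using Suc step[of k] monoD[OF w(2), of k "Suc k"]
      by (intro add_mono) (auto elim!: order_trans intro!: mult_left_mono)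
    finally show ?case by (simp add: algebra_simps)
  qed simp
  have fd: "(\<lambda>y. norm (f y - c)) absolutely_integrable_on ?D k" for c
    using fi[of k] unfolding dyadic_cube_def by (rule absolutely_integrable_cube_norm_diff)
  have const: "(\<lambda>_. c) absolutely_integrable_on ?D k" for c :: real
    by (simp add: dyadic_cube_def)
  have pos: "0 < 2 ^ k * t" using \<open>0 < t\<close> by simp
  have "average (\<lambda>y. norm (f y - average f (cube a t))) (?D k)
    \<le> average (\<lambda>y. norm (f y - average f (?D k)) + norm (average f (cube a t) - average f (?D k))) (?D k)"
  proof (rule average_mono)
    show "norm (f y - average f (cube a t))
      \<le> norm (f y - average f (?D k)) + norm (average f (cube a t) - average f (?D k))" for y
      by norm
  qed (intro set_integral_add(1) fd const)+
  also have "\<dots> = mean_oscillation f (?D k) + norm (average f (cube a t) - average f (?D k))"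
    using fi[of k] pos unfolding dyadic_cube_def mean_oscillation_def
    by (subst average_add) (auto intro: absolutely_integrable_cube_norm_diff)
  finally show ?thesis using w(1)[of k] avg by (simp add: algebra_simps)
qed

subsection \<open>The modulus of oscillation\<close>

text \<open>The function \<open>\<omega>\<close> of the overview, made real-valued for use in series
  and limits. For \<open>f\<close> in BMO the supremum is finite, so \<open>enn2real\<close> loses
  no information.\<close>

definition oscillation_modulus :: "(real^'n \<Rightarrow> complex^'m) \<Rightarrow> real \<Rightarrow> real" where
  "oscillation_modulus f r =
    enn2real (SUP (a, l) \<in> UNIV \<times> {0<..r}. ennreal (mean_oscillation f (cube a l)))"

lemma BMO_locally_integrable: "f \<in> BMO \<Longrightarrow> locally_integrable f"
  by (simp add: BMO_def)

lemma BMO_norm_finite: "f \<in> BMO \<Longrightarrow> BMO_norm f < \<infinity>"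
  by (simp add: BMO_def)

lemma oscillation_le_BMO_norm:
  "0 < l \<Longrightarrow> ennreal (mean_oscillation f (cube a l)) \<le> BMO_norm f"
  unfolding BMO_norm_def by (rule SUP_upper2[of "(a, l)"]) auto

lemma BMO_norm_leI:
  assumes "\<And>a l. 0 < l \<Longrightarrow> mean_oscillation f (cube a l) \<le> B"
  shows "BMO_norm f \<le> ennreal B"
  unfolding BMO_norm_def by (rule SUP_least) (auto intro: ennreal_leI assms)

lemma local_oscillation_le_BMO_norm:
  "(SUP (a, l) \<in> UNIV \<times> {0<..r}. ennreal (mean_oscillation f (cube a l))) \<le> BMO_norm f"
  unfolding BMO_norm_def by (rule SUP_subset_mono) auto

lemma ennreal_oscillation_modulus:
  assumes "f \<in> BMO"
  shows "ennreal (oscillation_modulus f r)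
    = (SUP (a, l) \<in> UNIV \<times> {0<..r}. ennreal (mean_oscillation f (cube a l)))"
  using le_less_trans[OF local_oscillation_le_BMO_norm BMO_norm_finite[OF assms]]
  unfolding oscillation_modulus_def by (intro ennreal_enn2real) simp

lemma oscillation_modulus_nonneg [simp]: "0 \<le> oscillation_modulus f r"
  by (simp add: oscillation_modulus_def)

lemma oscillation_le_modulus:
  assumes "f \<in> BMO" "0 < l" "l \<le> r"
  shows "mean_oscillation f (cube a l) \<le> oscillation_modulus f r"
proof -
  have "ennreal (mean_oscillation f (cube a l)) \<le> ennreal (oscillation_modulus f r)"
    unfolding ennreal_oscillation_modulus[OF assms(1)]
    using assms(2,3) by (intro SUP_upper2[of "(a, l)"]) auto
  then show ?thesis by simp
qed

lemma oscillation_modulus_mono: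
  assumes "f \<in> BMO" "r \<le> s"
  shows "oscillation_modulus f r \<le> oscillation_modulus f s"
proof -
  have "ennreal (oscillation_modulus f r) \<le> ennreal (oscillation_modulus f s)"
    unfolding ennreal_oscillation_modulus[OF assms(1)]
    using assms(2) by (intro SUP_subset_mono) auto
  then show ?thesis by simp
qed

lemma oscillation_modulus_le_BMO_norm:
  assumes "f \<in> BMO"
  shows "oscillation_modulus f r \<le> enn2real (BMO_norm f)"
  unfolding oscillation_modulus_def
  using BMO_norm_finite[OF assms] by (intro enn2real_mono local_oscillation_le_BMO_norm) simp

lemma VMO_iff:
  "f \<in> VMO \<longleftrightarrow> f \<in> BMO \<and> (oscillation_modulus f \<longlongrightarrow> 0) (at_right 0)"
proof -
  have "((\<lambda>r. ennreal (oscillation_modulus f r)) \<longlongrightarrow> ennreal 0) (at_right 0)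
    \<longleftrightarrow> (oscillation_modulus f \<longlongrightarrow> 0) (at_right 0)"
    by (rule tendsto_ennreal_iff) auto
  then show ?thesis
    unfolding VMO_def by (auto simp: ennreal_oscillation_modulus)
qed

section \<open>Dyadic sums of the modulus of oscillation\<close>

lemma summable_nat_geometric:
  fixes q :: real
  assumes "0 \<le> q" "q < 1"
  shows "summable (\<lambda>k. q ^ k * (1 + real k * b))"
proof -
  obtain r where r: "q < r" "r < 1" using dense[OF \<open>q < 1\<close>] by blast
  \<comment> \<open>The series with terms \<open>(k + 1) q^k\<close> is the derivative of the
    geometric series, hence converges inside its disc of convergence. The given terms are a linear
    combination of the two series.\<close>
  have "summable (\<lambda>k. diffs (\<lambda>_. 1 :: real) k * q ^ k)"
    using assms r by (intro termdiff_converges[of q r]) (auto intro!: summable_geometric)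
  then have s: "summable (\<lambda>k. (1 + real k) * q ^ k)" by (simp add: diffs_def)
  have g: "summable (\<lambda>k. q ^ k)" using assms by (intro summable_geometric) simp
  have "(\<lambda>k. q ^ k * (1 + real k * b)) = (\<lambda>k. b * ((1 + real k) * q ^ k) + (1 - b) * q ^ k)"
    by (simp add: fun_eq_iff algebra_simps)
  with s g show ?thesis by (simp add: summable_add summable_mult)
qed

text \<open>The geometric factor comes from the decay of the kernel, the linear one from telescoping
  the averages.\<close>

definition dyadic_weight :: "nat \<Rightarrow> real \<Rightarrow> nat \<Rightarrow> real" where
  "dyadic_weight n \<epsilon> k = (2 powr (- \<epsilon>)) ^ k * (1 + real k * 2 ^ n)"

text \<open>This is \<open>\<delta>(t)\<close> of the overview with the constant of
  \<open>kernel_le_dyadic_sum\<close> absorbed.\<close>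

definition dyadic_oscillation :: "(real^'n \<Rightarrow> complex^'m) \<Rightarrow> real \<Rightarrow> real \<Rightarrow> real" where
  "dyadic_oscillation f \<epsilon> t = 4 powr (real CARD('n) + \<epsilon>) *
    (\<Sum>k. dyadic_weight CARD('n) \<epsilon> k * oscillation_modulus f (2 ^ k * t))"

lemma dyadic_weight_nonneg [simp]: "0 \<le> dyadic_weight n \<epsilon> k"
  by (simp add: dyadic_weight_def)

lemma summable_dyadic_weight:
  assumes "0 < \<epsilon>"
  shows "summable (dyadic_weight n \<epsilon>)"
proof -
  have "2 powr (- \<epsilon>) < 2 powr 0" using assms by (intro powr_less_mono) auto
  then show ?thesis unfolding dyadic_weight_def by (intro summable_nat_geometric) auto
qed

lemma dyadic_term_le:
  fixes f :: "real^'n \<Rightarrow> complex^'m"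
  assumes "f \<in> BMO"
  shows "dyadic_weight n \<epsilon> k * oscillation_modulus f r
    \<le> dyadic_weight n \<epsilon> k * enn2real (BMO_norm f)"
  by (intro mult_left_mono oscillation_modulus_le_BMO_norm assms) simp

lemma summable_dyadic_oscillation:
  fixes f :: "real^'n \<Rightarrow> complex^'m"
  assumes "f \<in> BMO" "0 < \<epsilon>"
  shows "summable (\<lambda>k. dyadic_weight n \<epsilon> k * oscillation_modulus f (r k))"
  using dyadic_term_le[OF assms(1)]
  by (intro summable_comparison_test'[OF summable_mult2[OF summable_dyadic_weight[OF assms(2)]]]) auto

lemma dyadic_oscillation_nonneg:
  assumes "f \<in> BMO" "0 < \<epsilon>"
  shows "0 \<le> dyadic_oscillation f \<epsilon> t"
  unfolding dyadic_oscillation_def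
  by (intro mult_nonneg_nonneg suminf_nonneg summable_dyadic_oscillation assms) auto

text \<open>The term k = 0 has weight 1 and the prefactor is at least 1. Oscillations of
  \<open>f\<close> on cubes of side at most t can therefore be absorbed into the same bound as the
  convolution.\<close>

lemma oscillation_modulus_le_dyadic:
  fixes f :: "real^'n \<Rightarrow> complex^'m"
  assumes "f \<in> BMO" "0 < \<epsilon>"
  shows "oscillation_modulus f t \<le> dyadic_oscillation f \<epsilon> t"
proof -
  let ?b = "\<lambda>k. dyadic_weight CARD('n) \<epsilon> k * oscillation_modulus f (2 ^ k * t)"
  have "oscillation_modulus f t = (\<Sum>k\<in>{0}. ?b k)" by (simp add: dyadic_weight_def)
  also have "\<dots> \<le> suminf ?b"
    by (intro sum_le_suminf summable_dyadic_oscillation assms) auto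
  also have "\<dots> \<le> 4 powr (real CARD('n) + \<epsilon>) * suminf ?b"
  proof -
    have "1 \<le> 4 powr (real CARD('n) + \<epsilon>)" using assms(2) by (intro ge_one_powr_ge_zero) auto
    moreover have "0 \<le> suminf ?b" by (intro suminf_nonneg summable_dyadic_oscillation assms) auto
    ultimately show ?thesis using mult_right_mono by fastforce
  qed
  finally show ?thesis by (simp add: dyadic_oscillation_def)
qed

text \<open>Each term vanishes as \<open>t\<close> tends to 0, and all are dominated, uniformly in
  \<open>t\<close>, by the summable weights times the BMO norm; Tannery's theorem exchanges limit
  and sum.\<close>

lemma dyadic_oscillation_tendsto_0:
  fixes f :: "real^'n \<Rightarrow> complex^'m"
  assumes "f \<in> VMO" "0 < \<epsilon>"
  shows "(dyadic_oscillation f \<epsilon> \<longlongrightarrow> 0) (at_right 0)"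
proof -
  have f: "f \<in> BMO" and lim: "(oscillation_modulus f \<longlongrightarrow> 0) (at_right 0)"
    using assms(1) by (auto simp: VMO_iff)
  let ?b = "\<lambda>k t. dyadic_weight CARD('n) \<epsilon> k * oscillation_modulus f (2 ^ k * t)"
  have "((\<lambda>t. \<Sum>k. ?b k t) \<longlongrightarrow> (\<Sum>k::nat. 0)) (at_right 0)"
  proof (rule tannerys_theorem[THEN conjunct2, THEN conjunct2])
    show "(?b k \<longlongrightarrow> 0) (at_right 0)" for k
    proof -
      have "filterlim (\<lambda>t::real. 2 ^ k * t) (at_right 0) (at_right 0)"
        by (rule filterlim_times_pos[where c = "2 ^ k", simplified]) (auto intro: filterlim_ident)
      from filterlim_compose[OF lim this] show ?thesis
        by (rule tendsto_mult_right_zero)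
    qed
    show "\<forall>\<^sub>F (k, t) in at_top \<times>\<^sub>F at_right 0.
        norm (?b k t) \<le> dyadic_weight CARD('n) \<epsilon> k * enn2real (BMO_norm f)"
      using dyadic_term_le[OF f] by (intro always_eventually) auto
    show "summable (\<lambda>k. dyadic_weight CARD('n) \<epsilon> k * enn2real (BMO_norm f))"
      by (intro summable_mult2 summable_dyadic_weight assms)
  qed simp
  then show ?thesis
    unfolding dyadic_oscillation_def by (intro tendsto_mult_right_zero) simp
qed

section \<open>Integrals of decaying kernels against a BMO function minus its average\<close>

text \<open>The dyadic integral bound is applied to \<open>|f - f_P|\<close> with
  \<open>P = cube a t\<close>, and the averages over the enlargements are controlled by telescoping
  with \<open>w k\<close> equal to \<open>\<omega>(2^k t)\<close>.\<close>

lemma nn_integral_kernel_oscillation_le: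
  fixes f :: "real^'n \<Rightarrow> complex^'m"
  assumes f: "f \<in> BMO" and "0 < \<epsilon>" "0 < t" "x \<in> cube a t"
  shows "(\<integral>\<^sup>+ y. ennreal ((1 + norm (x - y) / t) powr (- real CARD('n) - \<epsilon>) / t ^ CARD('n)
      * norm (f y - average f (cube a t))) \<partial>lebesgue) \<le> ennreal (dyadic_oscillation f \<epsilon> t)"
proof -
  let ?g = "\<lambda>y. norm (f y - average f (cube a t))"
  note fl = BMO_locally_integrable[OF f]
  have g: "locally_integrable ?g"
    unfolding locally_integrable_def
  proof (intro allI impI)
    fix K :: "(real^'n) set" assume K: "compact K"
    then have "K \<in> lmeasurable" by (rule lmeasurable_compact)
    then have "(\<lambda>_. average f (cube a t)) absolutely_integrable_on K"
      unfolding set_integrable_def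
      by (intro integrable_scaleR_left integrable_real_indicator) (auto simp: fmeasurable_def)
    then show "?g absolutely_integrable_on K"
      using fl K unfolding locally_integrable_def
      by (intro set_integrable_norm set_integral_diff(1)) auto
  qed
  let ?s = "real CARD('n) + \<epsilon>"
  have "(\<integral>\<^sup>+ y. ennreal ((1 + norm (x - y) / t) powr (- real CARD('n) - \<epsilon>) / t ^ CARD('n) * ?g y) \<partial>lebesgue)
    \<le> ennreal (4 powr ?s) * (\<Sum>k. ennreal ((2 powr (- \<epsilon>)) ^ k * average ?g (dyadic_cube a t k)))"
    using assms by (intro nn_integral_kernel_le g) auto
  also have "\<dots> \<le> ennreal (4 powr ?s) *
      (\<Sum>k. ennreal (dyadic_weight CARD('n) \<epsilon> k * oscillation_modulus f (2 ^ k * t)))"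
  proof (intro mult_left_mono suminf_le ennreal_leI)
    fix k
    have "average ?g (dyadic_cube a t k) \<le> (1 + real k * 2 ^ CARD('n)) * oscillation_modulus f (2 ^ k * t)"
    proof (rule average_diff_dyadic_le[OF fl \<open>0 < t\<close>])
      show "mean_oscillation f (dyadic_cube a t k) \<le> oscillation_modulus f (2 ^ k * t)" for k
        unfolding dyadic_cube_def using \<open>0 < t\<close> by (intro oscillation_le_modulus f) auto
      show "mono (\<lambda>k. oscillation_modulus f (2 ^ k * t))"
        using \<open>0 < t\<close> by (intro monoI oscillation_modulus_mono f) auto
    qed
    then show "(2 powr (- \<epsilon>)) ^ k * average ?g (dyadic_cube a t k)
      \<le> dyadic_weight CARD('n) \<epsilon> k * oscillation_modulus f (2 ^ k * t)"
      by (simp add: dyadic_weight_def mult.assoc mult_left_mono)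
  qed auto
  also have "\<dots> = ennreal (dyadic_oscillation f \<epsilon> t)"
    unfolding dyadic_oscillation_def
    using summable_dyadic_oscillation[OF f \<open>0 < \<epsilon>\<close>]
    by (subst suminf_ennreal2) (auto simp: ennreal_mult suminf_nonneg)
  finally show ?thesis .
qed

text \<open>The norm of a matrix is here the Frobenius norm, so the Cauchy-Schwarz inequality in
  each row suffices.\<close>

lemma norm_matrix_vector_mult_le:
  fixes A :: "complex^'m^'k"
  shows "norm (A *v x) \<le> norm A * norm x"
proof -
  have row: "norm ((A *v x) $ i) \<le> norm (A $ i) * norm x" for i
  proof -
    have "norm ((A *v x) $ i) \<le> (\<Sum>j\<in>UNIV. norm (A $ i $ j) * norm (x $ j))"
      by (simp add: matrix_vector_mult_def norm_sum order_trans[OF norm_sum] norm_mult)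
    also have "\<dots> \<le> norm (A $ i) * norm x"
      using L2_set_mult_ineq[of "\<lambda>j. norm (A $ i $ j)" "\<lambda>j. norm (x $ j)" UNIV]
      by (simp add: norm_vec_def)
    finally show ?thesis .
  qed
  have "norm (A *v x) \<le> L2_set (\<lambda>i. norm (A $ i) * norm x) UNIV"
    unfolding norm_vec_def[of "A *v x"] by (intro L2_set_mono row) simp
  also have "\<dots> = norm A * norm x"
    by (simp add: norm_vec_def[of A] L2_set_left_distrib)
  finally show ?thesis .
qed

lemma bounded_bilinear_matrix_vector_mult:
  "bounded_bilinear ((*v) :: complex^'m^'k \<Rightarrow> complex^'m \<Rightarrow> complex^'k)"
proof
  show "\<exists>K. \<forall>A (x :: complex^'m). norm ((A :: complex^'m^'k) *v x) \<le> norm A * norm x * K"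
    by (intro exI[of _ 1] allI) (simp add: norm_matrix_vector_mult_le)
qed (simp_all add: matrix_vector_mult_def vec_eq_iff scaleR_sum_right algebra_simps sum.distrib)

lemma borel_measurable_matrix_vector_mult [measurable (raw)]:
  fixes A :: "'a \<Rightarrow> complex^'m^'k"
  assumes "A \<in> borel_measurable M" "x \<in> borel_measurable M"
  shows "(\<lambda>y. A y *v x y) \<in> borel_measurable M"
  using assms
  by (rule borel_measurable_continuous_Pair)
    (intro bounded_bilinear.continuous_on[OF bounded_bilinear_matrix_vector_mult]
      continuous_on_fst continuous_on_snd continuous_on_id)

text \<open>The kernel \<open>g\<close> is left general so that the estimate serves both a translate
  of \<open>\<phi>\<^sub>t\<close> and the difference of two translates. The bound is required
  almost everywhere because the value of \<open>\<phi>\<close> at the origin is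
  unrestricted.\<close>

lemma kernel_integral:
  fixes f :: "real^'n \<Rightarrow> complex^'m" and g :: "real^'n \<Rightarrow> complex^'m^'k"
  assumes f: "f \<in> BMO" and "0 < \<epsilon>" "0 < t" "x \<in> cube a t" "0 \<le> D"
    and [measurable]: "g \<in> borel_measurable lebesgue"
    and g: "AE y in lebesgue. norm (g y)
      \<le> D * ((1 + norm (x - y) / t) powr (- real CARD('n) - \<epsilon>) / t ^ CARD('n))"
  shows "integrable lebesgue (\<lambda>y. g y *v (f y - average f (cube a t)))"
    and "norm (LINT y|lebesgue. g y *v (f y - average f (cube a t))) \<le> D * dyadic_oscillation f \<epsilon> t"
proof -
  let ?K = "\<lambda>y. (1 + norm (x - y) / t) powr (- real CARD('n) - \<epsilon>) / t ^ CARD('n)"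
  let ?h = "\<lambda>y. f y - average f (cube a t)"
  have [measurable]: "f \<in> borel_measurable lebesgue"
    using f by (intro locally_integrable_measurable BMO_locally_integrable)
  have [measurable]: "(\<lambda>y. norm (x - y)) \<in> borel_measurable lebesgue"
    by (rule measurable_completion) simp
  have "(\<integral>\<^sup>+ y. ennreal (norm (g y *v ?h y)) \<partial>lebesgue)
    \<le> (\<integral>\<^sup>+ y. ennreal D * ennreal (?K y * norm (?h y)) \<partial>lebesgue)"
  proof (rule nn_integral_mono_AE, use g in eventually_elim)
    fix y assume y: "norm (g y) \<le> D * ?K y"
    have "norm (g y *v ?h y) \<le> D * ?K y * norm (?h y)"
      by (rule order_trans[OF norm_matrix_vector_mult_le]) (intro mult_right_mono y norm_ge_zero)
    then show "ennreal (norm (g y *v ?h y)) \<le> ennreal D * ennreal (?K y * norm (?h y))"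
      using \<open>0 \<le> D\<close> \<open>0 < t\<close> by (simp add: mult.assoc flip: ennreal_mult)
  qed
  also have "\<dots> = ennreal D * (\<integral>\<^sup>+ y. ennreal (?K y * norm (?h y)) \<partial>lebesgue)"
    by (rule nn_integral_cmult) measurable
  also have "\<dots> \<le> ennreal D * ennreal (dyadic_oscillation f \<epsilon> t)"
    using assms by (intro mult_left_mono nn_integral_kernel_oscillation_le) auto
  also have "\<dots> = ennreal (D * dyadic_oscillation f \<epsilon> t)"
    using \<open>0 \<le> D\<close> dyadic_oscillation_nonneg[OF f \<open>0 < \<epsilon>\<close>] by (simp add: ennreal_mult)
  finally have *: "(\<integral>\<^sup>+ y. ennreal (norm (g y *v ?h y)) \<partial>lebesgue) \<le> \<dots>" .
  show i: "integrable lebesgue (\<lambda>y. g y *v ?h y)"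
    using le_less_trans[OF * ennreal_less_top] by (intro integrableI_bounded) auto
  have "ennreal (norm (LINT y|lebesgue. g y *v ?h y)) \<le> ennreal (D * dyadic_oscillation f \<epsilon> t)"
    using integral_norm_bound_ennreal[OF i] * by (rule order_trans)
  then show "norm (LINT y|lebesgue. g y *v ?h y) \<le> D * dyadic_oscillation f \<epsilon> t"
    using \<open>0 \<le> D\<close> dyadic_oscillation_nonneg[OF f \<open>0 < \<epsilon>\<close>] by simp
qed

text \<open>Substitution of \<open>y = x - t z\<close>: the Jacobian \<open>t^n\<close> cancels the
  normalisation of the dilation. It is carried out for \<open>lborel\<close> and transferred to the
  completion.\<close>

lemma lebesgue_integral_dilation_reflect:
  fixes \<phi> :: "real^'n \<Rightarrow> complex^'m^'m"
  assumes [measurable]: "\<phi> \<in> borel_measurable borel" and "integrable lebesgue \<phi>" "0 < t"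
  shows "integrable lebesgue (\<lambda>y. dilation t \<phi> (x - y))"
    and "(LINT y|lebesgue. dilation t \<phi> (x - y)) = (LINT y|lebesgue. \<phi> y)"
proof -
  let ?T = "\<lambda>z. x + (- t) *\<^sub>R z"
  have [measurable]: "(\<lambda>y. dilation t \<phi> (x - y)) \<in> borel_measurable borel"
    unfolding dilation_def by measurable
  have eq: "lborel = density (distr lborel borel ?T) (\<lambda>_. t ^ CARD('n))"
    using lborel_affine[of "- t" x] \<open>0 < t\<close> by simp
  have cancel: "t ^ CARD('n) *\<^sub>R dilation t \<phi> (x - ?T z) = \<phi> z" for z
    using \<open>0 < t\<close> by (simp add: dilation_def)
  have "integrable lborel \<phi>" using assms by (simp add: integrable_completion)
  then have "integrable lborel (\<lambda>y. dilation t \<phi> (x - y))"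
    by (subst eq) (use \<open>0 < t\<close> cancel in \<open>simp add: integrable_density integrable_distr_eq\<close>)
  then show "integrable lebesgue (\<lambda>y. dilation t \<phi> (x - y))"
    by (simp add: integrable_completion)
  have "(LINT y|lborel. dilation t \<phi> (x - y)) = (LINT z|lborel. t ^ CARD('n) *\<^sub>R dilation t \<phi> (x - ?T z))"
    by (subst eq) (use \<open>0 < t\<close> in \<open>simp add: integral_density integral_distr\<close>)
  also have "\<dots> = (LINT y|lborel. \<phi> y)" by (simp only: cancel)
  finally have "(LINT y|lborel. dilation t \<phi> (x - y)) = (LINT y|lborel. \<phi> y)" .
  then show "(LINT y|lebesgue. dilation t \<phi> (x - y)) = (LINT y|lebesgue. \<phi> y)"
    by (simp add: integral_completion)
qed

subsection \<open>Convolution with an approximate identity\<close>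

text \<open>Common setting of both claims: the Hoelder condition in the first and differentiability
  in the second each supply continuity off the origin.\<close>

locale approximate_identity_kernel =
  fixes \<phi> :: "real^'n \<Rightarrow> complex^'m^'m" and C \<epsilon> :: real
  assumes C_pos: "0 < C" and eps_pos: "0 < \<epsilon>"
    and continuous: "continuous_on (- {0}) \<phi>"
    and decay: "x \<noteq> 0 \<Longrightarrow> norm (\<phi> x) \<le> C * (1 + norm x) powr (- real CARD('n) - \<epsilon>)"
    and integral_eq: "(LINT x|lebesgue. \<phi> x) = mat 1"
begin

lemma borel_measurable_kernel [measurable]: "\<phi> \<in> borel_measurable borel"
  using continuous by (intro borel_measurable_continuous_countable_exceptions[of "{0}"]) auto

text \<open>The Bochner integral of a non-integrable function is 0 by convention, whereas the
  integral of \<open>\<phi>\<close> is the identity matrix.\<close>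

lemma integrable_kernel: "integrable lebesgue \<phi>"
proof (rule ccontr)
  assume "\<not> integrable lebesgue \<phi>"
  then have "(mat 1 :: complex^'m^'m) = 0"
    using integral_eq by (simp add: not_integrable_integral_eq)
  then have "(mat 1 :: complex^'m^'m) $ i $ i = 0" for i by simp
  then show False by (simp add: mat_def)
qed

lemma borel_measurable_dilation [measurable]: "dilation t \<phi> \<in> borel_measurable borel"
  unfolding dilation_def by measurable

lemma lebesgue_measurable_dilation_reflect [measurable]:
  "(\<lambda>y. dilation t \<phi> (x - y)) \<in> borel_measurable lebesgue"
  by (rule measurable_completion) simp

lemma norm_dilation_le:
  assumes "0 < t" "x \<noteq> y"
  shows "norm (dilation t \<phi> (x - y))
    \<le> C * ((1 + norm (x - y) / t) powr (- real CARD('n) - \<epsilon>) / t ^ CARD('n))"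
proof -
  have "norm (\<phi> ((1 / t) *\<^sub>R (x - y))) \<le> C * (1 + norm (x - y) / t) powr (- real CARD('n) - \<epsilon>)"
    using decay[of "(1 / t) *\<^sub>R (x - y)"] assms by simp
  then show ?thesis
    using \<open>0 < t\<close> by (simp add: dilation_def field_simps)
qed

lemma AE_norm_dilation_le:
  assumes "0 < t"
  shows "AE y in lebesgue. norm (dilation t \<phi> (x - y))
    \<le> C * ((1 + norm (x - y) / t) powr (- real CARD('n) - \<epsilon>) / t ^ CARD('n))"
proof -
  have "AE y in lebesgue. y \<noteq> x"
    by (rule AE_I'[of "{x}"]) auto
  then show ?thesis
    by eventually_elim (use norm_dilation_le[OF assms] in auto)
qed

text \<open>Since the total mass of \<open>\<phi>\<^sub>t\<close> is the identity, convolution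
  reproduces constants, and a constant can be split off from \<open>f\<close>.\<close>

lemma
  assumes f: "f \<in> BMO" and "0 < t"
  shows integrable_dilation_diff:
      "integrable lebesgue (\<lambda>y. dilation t \<phi> (x - y) *v (f y - average f (cube a t)))" (is ?int)
    and convolution_eq: "convolution (dilation t \<phi>) f x = average f (cube a t)
      + (LINT y|lebesgue. dilation t \<phi> (x - y) *v (f y - average f (cube a t)))" (is ?eq)
proof -
  interpret mv: bounded_bilinear "(*v) :: complex^'m^'m \<Rightarrow> complex^'m \<Rightarrow> complex^'m"
    by (rule bounded_bilinear_matrix_vector_mult)
  have x: "x \<in> cube x t" using \<open>0 < t\<close> by (simp add: mem_cube)
  let ?g = "\<lambda>y. dilation t \<phi> (x - y)"
  note g = lebesgue_integral_dilation_reflect[OF borel_measurable_kernel integrable_kernel \<open>0 < t\<close>, of x]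
  have c: "integrable lebesgue (\<lambda>y. ?g y *v c)" "(LINT y|lebesgue. ?g y *v c) = c" for c
    using integrable_bounded_linear[OF mv.bounded_linear_left g(1)]
      integral_bounded_linear[OF mv.bounded_linear_left g(1)] g(2)
    by (simp_all add: integral_eq)
  \<comment> \<open>The kernel estimate needs a cube containing \<open>x\<close>, while
    \<open>a\<close> is arbitrary. Integrability is obtained for the cube based at \<open>x\<close>
    and then moved to the other constant.\<close>
  have "integrable lebesgue (\<lambda>y. ?g y *v (f y - average f (cube x t)))"
    using C_pos eps_pos assms x AE_norm_dilation_le[OF \<open>0 < t\<close>]
    by (intro kernel_integral(1)[where D = C and \<epsilon> = \<epsilon> and x = x]) auto
  from Bochner_Integration.integrable_add[OF this c(1)[of "average f (cube x t)"]]
  have "integrable lebesgue (\<lambda>y. ?g y *v f y)"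
    by (simp flip: mv.add_right)
  from Bochner_Integration.integrable_diff[OF this c(1)[of "average f (cube a t)"]] show i: ?int
    by (simp flip: mv.diff_right)
  show ?eq
    using Bochner_Integration.integral_add[OF c(1) i, of "average f (cube a t)"]
    by (simp add: convolution_def c(2) flip: mv.add_right)
qed

lemma norm_convolution_diff_average_le:
  assumes "f \<in> BMO" "0 < t" "x \<in> cube a t"
  shows "norm (convolution (dilation t \<phi>) f x - average f (cube a t)) \<le> C * dyadic_oscillation f \<epsilon> t"
  using C_pos eps_pos assms AE_norm_dilation_le[OF \<open>0 < t\<close>]
  by (simp add: convolution_eq[OF assms(1,2), of x a] kernel_integral(2))

text \<open>Dominated convergence along a sequence tending to \<open>x\<close>, with the average
  over \<open>cube x t\<close> kept fixed. Continuity is what makes the convolution locally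
  integrable.\<close>

lemma continuous_convolution:
  assumes f: "f \<in> BMO" and "0 < t"
  shows "continuous_on UNIV (convolution (dilation t \<phi>) f)"
proof (rule continuous_on_sequentiallyI)
  fix u :: "nat \<Rightarrow> real^'n" and x
  assume u: "u \<longlonglongrightarrow> x"
  let ?n = "real CARD('n)"
  let ?h = "\<lambda>y. f y - average f (cube x t)"
  let ?K = "\<lambda>y. (1 + norm (x - y) / t) powr (- ?n - \<epsilon>) / t ^ CARD('n)"
  let ?w = "\<lambda>y. C * 2 powr (?n + \<epsilon>) * (?K y * norm (?h y))"
  interpret mv: bounded_bilinear "(*v) :: complex^'m^'m \<Rightarrow> complex^'m \<Rightarrow> complex^'m"
    by (rule bounded_bilinear_matrix_vector_mult)
  have [measurable]: "f \<in> borel_measurable lebesgue"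
    using f by (intro locally_integrable_measurable BMO_locally_integrable)
  have [measurable]: "(\<lambda>y. norm (x - y)) \<in> borel_measurable lebesgue"
    by (rule measurable_completion) simp
  \<comment> \<open>Moving the centre by less than t changes \<open>1 + |x - y| / t\<close> by at
    most a factor 2. This explains the constant \<open>2 powr (n + \<epsilon>)\<close> in the
    majorant and the shift of the sequence by N.\<close>
  obtain N where N: "\<And>k. N \<le> k \<Longrightarrow> dist (u k) x < t"
    using u \<open>0 < t\<close> unfolding lim_sequentially by blast
  have x: "x \<in> cube x t" using \<open>0 < t\<close> by (simp add: mem_cube)
  have le: "(\<integral>\<^sup>+ y. ennreal (norm (?K y * norm (?h y))) \<partial>lebesgue) \<le> ennreal (dyadic_oscillation f \<epsilon> t)"
    using nn_integral_kernel_oscillation_le[OF f eps_pos \<open>0 < t\<close> x] \<open>0 < t\<close> by (simp add: abs_mult)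
  have "integrable lebesgue (\<lambda>y. ?K y * norm (?h y))"
  proof (rule integrableI_bounded)
    show "(\<integral>\<^sup>+ y. ennreal (norm (?K y * norm (?h y))) \<partial>lebesgue) < \<infinity>"
      using le_less_trans[OF le ennreal_less_top] by simp
  qed measurable
  then have w: "integrable lebesgue ?w" by (rule integrable_mult_right)
  have lim: "(\<lambda>k. LINT y|lebesgue. dilation t \<phi> (u (k + N) - y) *v ?h y)
    \<longlonglongrightarrow> (LINT y|lebesgue. dilation t \<phi> (x - y) *v ?h y)"
  proof (rule integral_dominated_convergence[where w = ?w])
    \<comment> \<open>For \<open>y\<close> different from \<open>x\<close>, the limiting argument of
      \<open>\<phi>\<close> is nonzero, so \<open>\<phi>\<close> is continuous there.\<close>
    have "AE y in lebesgue. y \<noteq> x" by (rule AE_I'[of "{x}"]) auto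
    then show "AE y in lebesgue. (\<lambda>k. dilation t \<phi> (u (k + N) - y) *v ?h y)
      \<longlonglongrightarrow> dilation t \<phi> (x - y) *v ?h y"
    proof eventually_elim
      case (elim y)
      have "isCont \<phi> ((1 / t) *\<^sub>R (x - y))"
        using elim \<open>0 < t\<close> continuous continuous_on_eq_continuous_at[of "- {0 :: real^'n}" \<phi>]
        by (simp add: open_Compl)
      moreover have "(\<lambda>k. (1 / t) *\<^sub>R (u (k + N) - y)) \<longlonglongrightarrow> (1 / t) *\<^sub>R (x - y)"
        by (intro tendsto_intros LIMSEQ_ignore_initial_segment u)
      ultimately have "(\<lambda>k. \<phi> ((1 / t) *\<^sub>R (u (k + N) - y))) \<longlonglongrightarrow> \<phi> ((1 / t) *\<^sub>R (x - y))"
        by (rule isCont_tendsto_compose)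
      then show ?case
        unfolding dilation_def by (intro mv.tendsto tendsto_intros)
    qed
    fix k
    show "AE y in lebesgue. norm (dilation t \<phi> (u (k + N) - y) *v ?h y) \<le> ?w y"
      using AE_norm_dilation_le[OF \<open>0 < t\<close>, of "u (k + N)"]
    proof eventually_elim
      case (elim y)
      have "norm (x - y) \<le> norm (u (k + N) - y) + dist (u (k + N)) x"
        unfolding dist_norm by norm
      then have "norm (x - y) \<le> norm (u (k + N) - y) + t" using N[of "k + N"] by simp
      then have "norm (x - y) / t \<le> norm (u (k + N) - y) / t + 1"
        using \<open>0 < t\<close> by (simp add: field_simps)
      moreover have "0 \<le> norm (u (k + N) - y) / t" using \<open>0 < t\<close> by simp
      moreover have "(1 + p) / 2 \<le> 1 + q" if "p \<le> q + 1" "0 \<le> q" for p q :: real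
        using that by simp
      ultimately have "(1 + norm (x - y) / t) / 2 \<le> 1 + norm (u (k + N) - y) / t"
        by blast
      then have "(1 + norm (u (k + N) - y) / t) powr (- ?n - \<epsilon>) \<le> ((1 + norm (x - y) / t) / 2) powr (- ?n - \<epsilon>)"
        using \<open>0 < t\<close> eps_pos by (intro powr_mono2') (auto simp: add_pos_nonneg)
      also have "\<dots> = 2 powr (?n + \<epsilon>) * (1 + norm (x - y) / t) powr (- ?n - \<epsilon>)"
      proof -
        have "(p / 2) powr (- ?n - \<epsilon>) = 2 powr (?n + \<epsilon>) * p powr (- ?n - \<epsilon>)" if "0 \<le> p" for p :: real
          using powr_minus_divide[of 2 "?n + \<epsilon>"] that by (simp add: powr_divide)
        then show ?thesis using \<open>0 < t\<close> by simp
      qed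
      finally have "norm (dilation t \<phi> (u (k + N) - y)) \<le> C * 2 powr (?n + \<epsilon>) * ?K y"
        using elim C_pos \<open>0 < t\<close>
        by (auto elim!: order_trans intro!: divide_right_mono mult_left_mono simp: mult.assoc)
      then have "norm (dilation t \<phi> (u (k + N) - y) *v ?h y) \<le> C * 2 powr (?n + \<epsilon>) * ?K y * norm (?h y)"
        by (rule order_trans[OF norm_matrix_vector_mult_le mult_right_mono]) simp
      then show ?case by (simp only: mult.assoc)
    qed
  qed (use w in measurable)
  then have "(\<lambda>k. convolution (dilation t \<phi>) f (u (k + N))) \<longlonglongrightarrow> convolution (dilation t \<phi>) f x"
    unfolding convolution_eq[OF f \<open>0 < t\<close>, of _ x] by (intro tendsto_intros)
  then show "(\<lambda>k. convolution (dilation t \<phi>) f (u k)) \<longlonglongrightarrow> convolution (dilation t \<phi>) f x"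
    by (rule LIMSEQ_offset)
qed

end

section \<open>Covering large cubes by cubes of side t\<close>

lemma average_le_const:
  fixes h :: "real^'n \<Rightarrow> real"
  assumes "h absolutely_integrable_on cube a l" "0 < l" "\<And>x. x \<in> cube a l \<Longrightarrow> h x \<le> B"
  shows "average h (cube a l) \<le> B"
  using average_mono[OF assms(1) absolutely_integrable_const_cube, of B] assms(2,3) by simp

lemma cube_grid_cover:
  assumes "x \<in> cube a l" "l \<le> real N * t" "0 < t" "0 < N"
  shows "\<exists>i \<in> UNIV \<rightarrow>\<^sub>E {..<N}. x \<in> cube (\<chi> j. a $ j + real (i j) * t) t"
proof -
  have "\<exists>m<N. a $ j + real m * t \<le> x $ j \<and> x $ j \<le> a $ j + real m * t + t" for j
  proof -
    have x: "a $ j \<le> x $ j" "x $ j \<le> a $ j + l" using assms(1) by (auto simp: mem_cube)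
    define m where "m = nat \<lfloor>(x $ j - a $ j) / t\<rfloor>"
    have "0 \<le> (x $ j - a $ j) / t" using x assms(3) by simp
    then have "real m \<le> (x $ j - a $ j) / t" "(x $ j - a $ j) / t \<le> real m + 1"
      unfolding m_def by linarith+
    then have m: "real m * t \<le> x $ j - a $ j" "x $ j - a $ j \<le> real m * t + t"
      using assms(3) by (simp_all add: field_simps)
    show ?thesis
    proof (cases "m < N")
      case True
      with m show ?thesis by (intro exI[of _ m]) auto
    next
      \<comment> \<open>The floor can only reach N when the coordinate lies exactly on the far face
        of the grid; the last closed cell, of index N - 1, contains that face.\<close>
      case False
      then have "real N * t \<le> real m * t" using assms(3) by (intro mult_right_mono) auto
      then have "x $ j - a $ j = real N * t" using m x assms(2) by linarith
      moreover have "real N = real (N - 1) + 1" using assms(4) by simp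
      ultimately have "x $ j - a $ j = real (N - 1) * t + t" by (simp only: distrib_right mult_1)
      then show ?thesis using assms(3,4) by (intro exI[of _ "N - 1"]) auto
    qed
  qed
  then obtain i where "\<And>j. i j < N \<and> a $ j + real (i j) * t \<le> x $ j \<and> x $ j \<le> a $ j + real (i j) * t + t"
    by metis
  then show ?thesis by (intro bexI[of _ i]) (auto simp: mem_cube)
qed

text \<open>A grid of cells of side t covers the large cube with total volume at most
  \<open>2^n\<close> times its own. Overlapping faces and protruding cells do no harm since
  \<open>h\<close> is nonnegative.\<close>

lemma average_le_of_smaller_cubes:
  fixes h :: "real^'n \<Rightarrow> real"
  assumes h: "locally_integrable h" and nonneg: "\<And>x. 0 \<le> h x"
    and "0 < t" "t \<le> l" and A: "\<And>b. average h (cube b t) \<le> A"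
  shows "average h (cube a l) \<le> 2 ^ CARD('n) * A"
proof -
  define N where "N = nat \<lceil>l / t\<rceil>"
  \<comment> \<open>Rounding up a number that is at least 1 at most doubles it; this is the source
    of the factor 2 per dimension.\<close>
  have "1 \<le> l / t" using assms by simp
  then have N: "l / t \<le> real N" "real N \<le> 2 * (l / t)" "0 < N"
    unfolding N_def by linarith+
  then have Nt: "l \<le> real N * t" "real N * t \<le> 2 * l"
    using \<open>0 < t\<close> by (simp_all add: field_simps)
  define I where "I = (UNIV :: 'n set) \<rightarrow>\<^sub>E {..<N}"
  define P where "P i = cube (\<chi> j. a $ j + real (i j) * t) t" for i :: "'n \<Rightarrow> nat"
  have I: "finite I" "card I = N ^ CARD('n)"
    unfolding I_def by (auto simp: card_PiE intro: finite_PiE)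
  note hi = locally_integrable_cube[OF h, unfolded set_integrable_def]
  have "0 \<le> A" using order_trans[OF average_nonneg A] nonneg by blast
  have "(LINT x:cube a l|lebesgue. h x) \<le> (LINT x|lebesgue. (\<Sum>i\<in>I. indicator (P i) x *\<^sub>R h x))"
    unfolding set_lebesgue_integral_def
  proof (rule integral_mono)
    show "integrable lebesgue (\<lambda>x. \<Sum>i\<in>I. indicator (P i) x *\<^sub>R h x)"
      unfolding P_def by (intro Bochner_Integration.integrable_sum hi)
    fix x
    show "indicator (cube a l) x *\<^sub>R h x \<le> (\<Sum>i\<in>I. indicator (P i) x *\<^sub>R h x)"
    proof (cases "x \<in> cube a l")
      case True
      then obtain i where i: "i \<in> I" "x \<in> P i"
        using cube_grid_cover[OF _ Nt(1) \<open>0 < t\<close> N(3)] unfolding I_def P_def by blast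
      then have "indicator (cube a l) x *\<^sub>R h x = (\<Sum>i\<in>{i}. indicator (P i) x *\<^sub>R h x)"
        using True by simp
      also have "\<dots> \<le> (\<Sum>i\<in>I. indicator (P i) x *\<^sub>R h x)"
        using I(1) i(1) nonneg by (intro sum_mono2) auto
      finally show ?thesis .
    qed (auto intro!: sum_nonneg mult_nonneg_nonneg nonneg)
  qed (rule hi)
  also have "\<dots> = (\<Sum>i\<in>I. t ^ CARD('n) * average h (P i))"
    using \<open>0 < t\<close> unfolding P_def
    by (subst Bochner_Integration.integral_sum[OF hi]) (simp add: average_def set_lebesgue_integral_def)
  also have "\<dots> \<le> (\<Sum>i\<in>I. t ^ CARD('n) * A)"
    unfolding P_def using \<open>0 < t\<close> by (intro sum_mono mult_left_mono A) auto
  also have "\<dots> = (real N * t) ^ CARD('n) * A"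
    by (simp add: I(2) power_mult_distrib)
  also have "\<dots> \<le> (2 * l) ^ CARD('n) * A"
    using Nt(2) \<open>0 < t\<close> \<open>0 \<le> A\<close> by (intro mult_right_mono power_mono) auto
  finally show ?thesis
    using assms(3,4) by (simp add: average_def power_mult_distrib field_simps)
qed

lemma continuous_imp_locally_integrable:
  fixes f :: "real^'n \<Rightarrow> 'b::euclidean_space"
  assumes "continuous_on UNIV f"
  shows "locally_integrable f"
  unfolding locally_integrable_def
proof (intro allI impI)
  fix K :: "(real^'n) set" assume K: "compact K"
  have "f \<in> borel_measurable borel" using assms by (rule borel_measurable_continuous_onI)
  moreover have "K \<in> sets borel" using K by (intro borel_closed compact_imp_closed)
  moreover have "integrable lborel (\<lambda>x. indicator K x *\<^sub>R f x)"
    using K continuous_on_subset[OF assms] by (intro borel_integrable_compact) auto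
  ultimately show "f absolutely_integrable_on K"
    unfolding set_integrable_def by (subst integrable_completion) auto
qed

lemma locally_integrable_diff:
  assumes "locally_integrable f" "locally_integrable g"
  shows "locally_integrable (\<lambda>x. f x - g x)"
  using assms unfolding locally_integrable_def by (auto intro: set_integral_diff(1))

lemma locally_integrable_norm:
  "locally_integrable f \<Longrightarrow> locally_integrable (\<lambda>x. norm (f x))"
  unfolding locally_integrable_def by (auto intro: set_integrable_norm)

section \<open>The approximation error in BMO\<close>

context approximate_identity_kernel
begin

lemma locally_integrable_convolution:
  assumes "f \<in> BMO" "0 < t"
  shows "locally_integrable (convolution (dilation t \<phi>) f)"
  by (intro continuous_imp_locally_integrable continuous_convolution assms)

lemma mean_oscillation_convolution_diff_le:
  assumes f: "f \<in> BMO" and "0 < t" "0 < l"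
  shows "mean_oscillation (\<lambda>x. convolution (dilation t \<phi>) f x - f x) (cube a l)
    \<le> 2 * 2 ^ CARD('n) * (C + 1) * dyadic_oscillation f \<epsilon> t"
proof -
  let ?g = "convolution (dilation t \<phi>) f"
  let ?\<delta> = "dyadic_oscillation f \<epsilon> t"
  note fl = BMO_locally_integrable[OF f]
  note gl = locally_integrable_convolution[OF f \<open>0 < t\<close>]
  note fi = locally_integrable_cube[OF fl] and gi = locally_integrable_cube[OF gl]
  have \<delta>: "0 \<le> ?\<delta>" by (rule dyadic_oscillation_nonneg[OF f eps_pos])
  \<comment> \<open>Since \<open>cube b s\<close> lies inside \<open>cube b t\<close>, the pointwise
    bound around the average over the larger cube applies on all of it.\<close>
  have g: "average (\<lambda>x. norm (?g x - average f (cube b t))) (cube b s) \<le> C * ?\<delta>"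
    if "0 < s" "s \<le> t" for b s
  proof (rule average_le_const)
    fix x assume "x \<in> cube b s"
    then have "x \<in> cube b t"
      using that(2) unfolding mem_cube by (meson add_left_mono order_trans)
    then show "norm (?g x - average f (cube b t)) \<le> C * ?\<delta>"
      by (rule norm_convolution_diff_average_le[OF f \<open>0 < t\<close>])
  qed (use that in \<open>auto intro: absolutely_integrable_cube_norm_diff gi\<close>)
  have osc: "mean_oscillation f (cube b s) \<le> ?\<delta>" if "0 < s" "s \<le> t" for b s
    using oscillation_le_modulus[OF f that] oscillation_modulus_le_dyadic[OF f eps_pos]
    by (rule order_trans)
  show ?thesis
  proof (cases "l \<le> t")
    case True
    have "mean_oscillation (\<lambda>x. ?g x - f x) (cube a l)
      \<le> mean_oscillation ?g (cube a l) + mean_oscillation f (cube a l)"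
      by (intro mean_oscillation_diff_le gi fi)
    also have "\<dots> \<le> 2 * (C * ?\<delta>) + ?\<delta>"
      using mean_oscillation_le[OF gi[of a l] \<open>0 < l\<close>, of "average f (cube a t)"]
        g[OF \<open>0 < l\<close> True, of a] osc[OF \<open>0 < l\<close> True, of a] by linarith
    also have "\<dots> \<le> 1 * (2 * (C + 1) * ?\<delta>)" using \<delta> by (simp add: algebra_simps)
    also have "\<dots> \<le> 2 ^ CARD('n) * (2 * (C + 1) * ?\<delta>)"
      using \<delta> C_pos by (intro mult_right_mono) auto
    finally show ?thesis by (simp add: algebra_simps)
  next
    case False
    \<comment> \<open>On large cubes the average of \<open>|g - f|\<close> is bounded instead of the
      oscillation: its integral adds up over a covering, while oscillations refer to a different
      mean on each cell. \<open>mean_oscillation_le\<close> with constant 0 then returns to the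
      oscillation.\<close>
    have "average (\<lambda>x. norm (?g x - f x)) (cube a l) \<le> 2 ^ CARD('n) * ((C + 1) * ?\<delta>)"
    proof (rule average_le_of_smaller_cubes[OF _ _ \<open>0 < t\<close>])
      fix b
      have "average (\<lambda>x. norm (?g x - f x)) (cube b t)
        \<le> average (\<lambda>x. norm (?g x - average f (cube b t)) + norm (f x - average f (cube b t))) (cube b t)"
      proof (rule average_mono)
        show "norm (?g x - f x) \<le> norm (?g x - average f (cube b t)) + norm (f x - average f (cube b t))" for x
          by norm
        show "(\<lambda>x. norm (?g x - f x)) absolutely_integrable_on cube b t"
          by (intro locally_integrable_cube locally_integrable_norm locally_integrable_diff fl gl)
      qed (intro set_integral_add(1) absolutely_integrable_cube_norm_diff fi gi)
      also have "\<dots> \<le> C * ?\<delta> + ?\<delta>"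
        using g[of t b] osc[of t b] \<open>0 < t\<close>
        by (subst average_add) (auto intro: absolutely_integrable_cube_norm_diff fi gi simp: mean_oscillation_def)
      finally show "average (\<lambda>x. norm (?g x - f x)) (cube b t) \<le> (C + 1) * ?\<delta>"
        by (simp add: algebra_simps)
    qed (use False in \<open>auto intro!: locally_integrable_norm locally_integrable_diff fl gl\<close>)
    then show ?thesis
      using mean_oscillation_le[OF set_integral_diff(1)[OF gi[of a l] fi[of a l]] \<open>0 < l\<close>, of 0]
      by (simp add: algebra_simps)
  qed
qed

lemma BMO_norm_convolution_diff_le:
  assumes "f \<in> BMO" "0 < t"
  shows "BMO_norm (\<lambda>x. convolution (dilation t \<phi>) f x - f x)
    \<le> ennreal (2 * 2 ^ CARD('n) * (C + 1) * dyadic_oscillation f \<epsilon> t)"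
  by (intro BMO_norm_leI mean_oscillation_convolution_diff_le assms)

lemma convolution_in_BMO:
  assumes f: "f \<in> BMO" and "0 < t"
  shows "convolution (dilation t \<phi>) f \<in> BMO"
proof -
  let ?g = "convolution (dilation t \<phi>) f"
  let ?B = "2 * 2 ^ CARD('n) * (C + 1) * dyadic_oscillation f \<epsilon> t + enn2real (BMO_norm f)"
  note fl = BMO_locally_integrable[OF f]
  note gl = locally_integrable_convolution[OF f \<open>0 < t\<close>]
  have "BMO_norm ?g \<le> ennreal ?B"
  proof (rule BMO_norm_leI)
    fix a :: "real^'n" and l :: real assume "0 < l"
    have "mean_oscillation ?g (cube a l)
      \<le> mean_oscillation (\<lambda>x. ?g x - f x) (cube a l) + mean_oscillation f (cube a l)"
      using mean_oscillation_add_le[OF locally_integrable_cube[OF locally_integrable_diff[OF gl fl]]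
          locally_integrable_cube[OF fl]] by simp
    also have "\<dots> \<le> ?B"
      using order_trans[OF oscillation_le_modulus[OF f \<open>0 < l\<close> order_refl] oscillation_modulus_le_BMO_norm[OF f]]
      by (intro add_mono mean_oscillation_convolution_diff_le[OF f \<open>0 < t\<close> \<open>0 < l\<close>])
    finally show "mean_oscillation ?g (cube a l) \<le> ?B" .
  qed
  then have "BMO_norm ?g < \<infinity>" using le_less_trans by fastforce
  with gl show ?thesis by (simp add: BMO_def)
qed

lemma VMO_tendsto_BMO_convolution:
  assumes "f \<in> VMO"
  shows "tendsto_BMO (\<lambda>t. convolution (dilation t \<phi>) f) f (at_right 0)"
  unfolding tendsto_BMO_def
proof (intro conjI)
  show f: "f \<in> BMO" using assms by (simp add: VMO_iff)
  have pos: "\<forall>\<^sub>F t in at_right 0. (0::real) < t" by (rule eventually_at_right_less)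
  show "\<forall>\<^sub>F t in at_right 0. convolution (dilation t \<phi>) f \<in> BMO"
    using pos by eventually_elim (rule convolution_in_BMO[OF f])
  have "((\<lambda>t. 2 * 2 ^ CARD('n) * (C + 1) * dyadic_oscillation f \<epsilon> t) \<longlongrightarrow> 0) (at_right 0)"
    by (intro tendsto_mult_right_zero dyadic_oscillation_tendsto_0 assms eps_pos)
  then have "((\<lambda>t. ennreal (2 * 2 ^ CARD('n) * (C + 1) * dyadic_oscillation f \<epsilon> t)) \<longlongrightarrow> 0) (at_right 0)"
    by (metis ennreal_0 tendsto_ennrealI)
  then show "((\<lambda>t. BMO_norm (\<lambda>x. convolution (dilation t \<phi>) f x - f x)) \<longlongrightarrow> 0) (at_right 0)"
  proof (rule tendsto_sandwich[OF _ _ tendsto_const, rotated -1])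
    show "\<forall>\<^sub>F t in at_right 0. BMO_norm (\<lambda>x. convolution (dilation t \<phi>) f x - f x)
      \<le> ennreal (2 * 2 ^ CARD('n) * (C + 1) * dyadic_oscillation f \<epsilon> t)"
      using pos by eventually_elim (rule BMO_norm_convolution_diff_le[OF f])
  qed simp
qed

section \<open>From convergence back to vanishing mean oscillation\<close>

text \<open>The difference of the kernels centred at \<open>x\<close> and \<open>a\<close> decays
  like the kernel itself, with the small additional factor \<open>n l / t\<close>. So
  \<open>kernel_integral\<close> applies to it and bounds \<open>|g(x) - g(a)|\<close> on the
  cube.\<close>

lemma mean_oscillation_convolution_le:
  assumes lip: "\<And>u h. norm h \<le> (1 + norm u) / 2 \<Longrightarrow>
      norm (\<phi> (u + h) - \<phi> u) \<le> L * norm h * (1 + norm u) powr (- real CARD('n) - \<epsilon>)"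
    and "0 \<le> L" and f: "f \<in> BMO" and "0 < t" "0 < l" and l: "real CARD('n) * l \<le> t / 2"
  shows "mean_oscillation (convolution (dilation t \<phi>) f) (cube a l)
    \<le> 2 * (L * (real CARD('n) * l / t) * dyadic_oscillation f \<epsilon> t)"
proof -
  let ?g = "convolution (dilation t \<phi>) f"
  let ?h = "\<lambda>y. f y - average f (cube a t)"
  let ?M = "real CARD('n) * l / t"
  interpret mv: bounded_bilinear "(*v) :: complex^'m^'m \<Rightarrow> complex^'m \<Rightarrow> complex^'m"
    by (rule bounded_bilinear_matrix_vector_mult)
  note gi = locally_integrable_cube[OF locally_integrable_convolution[OF f \<open>0 < t\<close>]]
  have "average (\<lambda>x. norm (?g x - ?g a)) (cube a l) \<le> L * ?M * dyadic_oscillation f \<epsilon> t"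
  proof (rule average_le_const)
    fix x assume x: "x \<in> cube a l"
    have "a \<in> cube a l" using \<open>0 < l\<close> by (simp add: mem_cube)
    then have d: "norm (x - a) / t \<le> ?M"
      using dist_cube_le[OF x] \<open>0 < t\<close> by (simp add: divide_right_mono)
    have M: "?M \<le> 1 / 2" using l \<open>0 < t\<close> by (simp add: field_simps)
    let ?k = "\<lambda>y. dilation t \<phi> (x - y) - dilation t \<phi> (a - y)"
    \<comment> \<open>Both convolutions are expanded around the same average of \<open>f\<close>, so
      the constants cancel.\<close>
    have "?g x - ?g a = (LINT y|lebesgue. ?k y *v ?h y)"
      using Bochner_Integration.integral_diff[OF integrable_dilation_diff[OF f \<open>0 < t\<close>]
          integrable_dilation_diff[OF f \<open>0 < t\<close>], of x a a a]
      by (simp add: convolution_eq[OF f \<open>0 < t\<close>, of _ a] mv.diff_left)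
    also have "norm \<dots> \<le> L * ?M * dyadic_oscillation f \<epsilon> t"
    proof (rule kernel_integral(2)[OF f eps_pos \<open>0 < t\<close>])
      show "a \<in> cube a t" using \<open>0 < t\<close> by (simp add: mem_cube)
      show "0 \<le> L * ?M" using \<open>0 \<le> L\<close> \<open>0 < t\<close> \<open>0 < l\<close> by simp
      show "AE y in lebesgue. norm (?k y)
        \<le> L * ?M * ((1 + norm (a - y) / t) powr (- real CARD('n) - \<epsilon>) / t ^ CARD('n))"
      proof (rule AE_I2)
        fix y
        let ?u = "(1 / t) *\<^sub>R (a - y)" and ?v = "(1 / t) *\<^sub>R (x - a)"
        have nv: "norm ?v \<le> ?M" and nu: "norm ?u = norm (a - y) / t" using d \<open>0 < t\<close> by simp_all
        \<comment> \<open>The restriction on \<open>l\<close> makes the rescaled increment at most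
          1/2, which is admissible for every \<open>?u\<close>.\<close>
        have "norm ?v \<le> (1 + norm ?u) / 2"
          by (rule order_trans[OF order_trans[OF nv M]]) simp
        from lip[OF this] have "norm (\<phi> (?u + ?v) - \<phi> ?u)
          \<le> L * norm ?v * (1 + norm ?u) powr (- real CARD('n) - \<epsilon>)" .
        also have "\<dots> \<le> L * ?M * (1 + norm ?u) powr (- real CARD('n) - \<epsilon>)"
          using nv \<open>0 \<le> L\<close> by (intro mult_right_mono mult_left_mono) auto
        finally have "norm (\<phi> (?u + ?v) - \<phi> ?u)
          \<le> L * ?M * (1 + norm (a - y) / t) powr (- real CARD('n) - \<epsilon>)" unfolding nu .
        moreover have "?u + ?v = (1 / t) *\<^sub>R (x - y)" by (simp flip: scaleR_add_right)
        ultimately have "norm (\<phi> ((1 / t) *\<^sub>R (x - y)) - \<phi> ?u)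
          \<le> L * ?M * (1 + norm (a - y) / t) powr (- real CARD('n) - \<epsilon>)" by simp
        then have "1 / t ^ CARD('n) * norm (\<phi> ((1 / t) *\<^sub>R (x - y)) - \<phi> ?u)
          \<le> 1 / t ^ CARD('n) * (L * ?M * (1 + norm (a - y) / t) powr (- real CARD('n) - \<epsilon>))"
          using \<open>0 < t\<close> by (intro mult_left_mono) auto
        moreover have "norm (?k y) = 1 / t ^ CARD('n) * norm (\<phi> ((1 / t) *\<^sub>R (x - y)) - \<phi> ?u)"
          using \<open>0 < t\<close> by (simp add: dilation_def flip: scaleR_diff_right)
        ultimately show "norm (?k y)
          \<le> L * ?M * ((1 + norm (a - y) / t) powr (- real CARD('n) - \<epsilon>) / t ^ CARD('n))"
          by (simp add: mult.commute)
      qed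
    qed measurable
    finally show "norm (?g x - ?g a) \<le> L * ?M * dyadic_oscillation f \<epsilon> t" .
  qed (use \<open>0 < l\<close> in \<open>auto intro: absolutely_integrable_cube_norm_diff gi\<close>)
  then show ?thesis
    using mean_oscillation_le[OF gi[of a l] \<open>0 < l\<close>, of "?g a"] by linarith
qed

text \<open>One \<open>t\<close> is fixed for which \<open>\<phi>\<^sub>t * f\<close> is close to
  \<open>f\<close> in BMO. The oscillation of \<open>f\<close> is then at most that small error plus
  the oscillation of the convolution, which is linear in the side of the cube.\<close>

lemma VMO_if_tendsto_BMO_convolution:
  assumes lip: "\<And>u h. norm h \<le> (1 + norm u) / 2 \<Longrightarrow>
      norm (\<phi> (u + h) - \<phi> u) \<le> L * norm h * (1 + norm u) powr (- real CARD('n) - \<epsilon>)"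
    and "0 \<le> L" and f: "f \<in> BMO"
    and lim: "tendsto_BMO (\<lambda>t. convolution (dilation t \<phi>) f) f (at_right 0)"
  shows "f \<in> VMO"
  unfolding VMO_iff
proof (intro conjI f tendstoI)
  fix e :: real assume "0 < e"
  have "((\<lambda>t. BMO_norm (\<lambda>x. convolution (dilation t \<phi>) f x - f x)) \<longlongrightarrow> 0) (at_right 0)"
    using lim by (simp add: tendsto_BMO_def)
  then have "\<forall>\<^sub>F t in at_right 0. BMO_norm (\<lambda>x. convolution (dilation t \<phi>) f x - f x) < ennreal (e / 3)"
    by (rule order_tendstoD) (use \<open>0 < e\<close> in simp)
  then have "\<forall>\<^sub>F t in at_right 0. BMO_norm (\<lambda>x. convolution (dilation t \<phi>) f x - f x) < ennreal (e / 3) \<and> 0 < t"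
    using eventually_at_right_less by (rule eventually_conj)
  from eventually_happens'[OF trivial_limit_at_right_real this]
  obtain t where t: "BMO_norm (\<lambda>x. convolution (dilation t \<phi>) f x - f x) < ennreal (e / 3)" "0 < t"
    by blast
  let ?g = "convolution (dilation t \<phi>) f"
  define D where "D = 2 * (L * (real CARD('n) / t) * dyadic_oscillation f \<epsilon> t)"
  have D: "0 \<le> D"
    unfolding D_def using \<open>0 \<le> L\<close> t(2) dyadic_oscillation_nonneg[OF f eps_pos] by simp
  \<comment> \<open>The first entry ensures \<open>n l \<le> t / 2\<close>, the second ensures
    \<open>l * D \<le> e / 3\<close>; \<open>D + 1\<close> keeps the denominator positive.\<close>
  define r where "r = min (t / (2 * real CARD('n))) (e / (3 * (D + 1)))"
  have "0 < r" using t(2) \<open>0 < e\<close> D by (simp add: r_def)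
  have "oscillation_modulus f s \<le> 2 * e / 3" if s: "0 < s" "s < r" for s
  proof -
    have "mean_oscillation f (cube a l) \<le> 2 * e / 3" if "0 < l" "l \<le> s" for a l
    proof -
      have "l < r" using s that by simp
      then have "l < t / (2 * real CARD('n))" "l < e / (3 * (D + 1))" by (simp_all add: r_def)
      then have l: "real CARD('n) * l \<le> t / 2" "l * (3 * (D + 1)) < e"
        using D pos_less_divide_eq[of "3 * (D + 1)" l e] by (simp_all add: field_simps)
      note gl = locally_integrable_convolution[OF f t(2)] and fl = BMO_locally_integrable[OF f]
      \<comment> \<open>Here \<open>f\<close> is written as \<open>g - (g - f)\<close>.\<close>
      have "mean_oscillation f (cube a l)
        \<le> mean_oscillation ?g (cube a l) + mean_oscillation (\<lambda>x. ?g x - f x) (cube a l)"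
        using mean_oscillation_diff_le[OF locally_integrable_cube[OF gl]
            locally_integrable_cube[OF locally_integrable_diff[OF gl fl]], of a l] by simp
      moreover have "mean_oscillation (\<lambda>x. ?g x - f x) (cube a l) \<le> e / 3"
        using le_less_trans[OF oscillation_le_BMO_norm[OF \<open>0 < l\<close>, of _ a] t(1)] \<open>0 < e\<close>
        by (simp add: ennreal_less_iff mean_oscillation_nonneg)
      moreover have "mean_oscillation ?g (cube a l) \<le> l * D"
        using mean_oscillation_convolution_le[OF lip \<open>0 \<le> L\<close> f t(2) \<open>0 < l\<close> l(1)]
        by (simp add: D_def mult.assoc mult.left_commute mult.commute)
      moreover have "l * D \<le> e / 3"
        using l(2) \<open>0 < l\<close> by (simp add: algebra_simps)
      ultimately show ?thesis by linarith
    qed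
    then show ?thesis
      unfolding oscillation_modulus_def using \<open>0 < e\<close>
      by (intro enn2real_leI SUP_least) (auto intro!: ennreal_leI)
  qed
  then have "\<And>s. 0 < s \<Longrightarrow> s < r \<Longrightarrow> dist (oscillation_modulus f s) 0 < e"
    using \<open>0 < e\<close> by (fastforce simp: dist_real_def)
  then show "\<forall>\<^sub>F s in at_right 0. dist (oscillation_modulus f s) 0 < e"
    using \<open>0 < r\<close> unfolding eventually_at_right_field by blast
qed

end

subsection \<open>Continuously differentiable kernels\<close>

text \<open>At a fixed nonzero point the Hoelder bound tends to 0 with the increment, because the
  exponent is positive.\<close>

lemma continuous_on_of_hoelder_off_0:
  fixes \<phi> :: "'a::real_normed_vector \<Rightarrow> 'b::real_normed_vector"
  assumes "0 < \<epsilon>" and hoelder: "\<And>x h. x \<noteq> 0 \<Longrightarrow> norm h < norm x / 2 \<Longrightarrow>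
      norm (\<phi> (x + h) - \<phi> x) \<le> C * norm h powr \<epsilon> / norm x powr p"
  shows "continuous_on (- {0}) \<phi>"
proof (rule continuous_at_imp_continuous_on, rule ballI)
  fix x :: 'a assume "x \<in> - {0}"
  then have x: "x \<noteq> 0" by simp
  have "((\<lambda>y. norm (y - x)) \<longlongrightarrow> 0) (at x)"
    by (intro tendsto_norm_zero LIM_zero tendsto_ident_at)
  then have "((\<lambda>y. norm (y - x) powr \<epsilon>) \<longlongrightarrow> 0 powr \<epsilon>) (at x)"
    using \<open>0 < \<epsilon>\<close> by (intro tendsto_powr') auto
  then have lim: "((\<lambda>y. C * norm (y - x) powr \<epsilon> / norm x powr p) \<longlongrightarrow> 0) (at x)"
    by (intro tendsto_divide_zero tendsto_mult_right_zero) simp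
  have "\<forall>\<^sub>F y in at x. dist y x < norm x / 2"
    by (rule order_tendstoD(2)[OF tendsto_dist[OF tendsto_ident_at tendsto_const]]) (simp add: x)
  then have "\<forall>\<^sub>F y in at x. norm (\<phi> y - \<phi> x) \<le> C * norm (y - x) powr \<epsilon> / norm x powr p"
    by eventually_elim (use hoelder[OF x, of "y - x" for y] in \<open>simp add: dist_norm\<close>)
  from Lim_null_comparison[OF this lim] have "(\<phi> \<longlongrightarrow> \<phi> x) (at x)"
    by (rule LIM_zero_cancel)
  then show "isCont \<phi> x" by (simp add: isCont_def)
qed

text \<open>The direction is expanded in the standard basis; bounding each of the n terms separately
  gives the factor n.\<close>

lemma norm_frechet_derivative_le_gradient:
  fixes \<phi> :: "real^'n \<Rightarrow> complex^'m^'m"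
  assumes "\<phi> differentiable (at x)"
  shows "norm (frechet_derivative \<phi> (at x) h) \<le> real CARD('n) * norm (gradient \<phi> x) * norm h"
proof -
  let ?D = "frechet_derivative \<phi> (at x)"
  have lin: "linear ?D"
    using assms by (rule linear_frechet_derivative)
  have "?D h = ?D (\<Sum>j\<in>UNIV. h $ j *\<^sub>R axis j 1)"
    using basis_expansion[of h] by (simp add: scalar_mult_eq_scaleR)
  also have "\<dots> = (\<Sum>j\<in>UNIV. h $ j *\<^sub>R gradient \<phi> x $ j)"
    by (simp add: linear_sum[OF lin] linear_scale[OF lin] gradient_def)
  finally have "norm (?D h) \<le> (\<Sum>j\<in>UNIV. norm (h $ j *\<^sub>R gradient \<phi> x $ j))"
    by (simp only: norm_sum)
  also have "\<dots> \<le> (\<Sum>j\<in>(UNIV :: 'n set). norm h * norm (gradient \<phi> x))"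
    using component_le_norm_cart[of h]
    by (intro sum_mono) (simp add: mult_mono Finite_Cartesian_Product.norm_nth_le)
  finally show ?thesis by (simp add: mult.assoc mult.left_commute mult.commute)
qed

text \<open>Mean value inequality on the ball of radius \<open>|h|\<close> about \<open>u\<close>.
  There \<open>1 + |x|\<close> is at least half of \<open>1 + |u|\<close>, so the gradient bound is
  uniform up to the factor \<open>2 powr p\<close>.\<close>

lemma increment_le_of_gradient_decay:
  fixes \<phi> :: "real^'n \<Rightarrow> complex^'m^'m"
  assumes diff: "\<And>x. \<phi> differentiable (at x)"
    and grad: "\<And>x. norm (gradient \<phi> x) \<le> C * (1 + norm x) powr (- p)"
    and "0 \<le> C" "0 \<le> p" and h: "norm h \<le> (1 + norm u) / 2"
  shows "norm (\<phi> (u + h) - \<phi> u) \<le> real CARD('n) * C * 2 powr p * norm h * (1 + norm u) powr (- p)"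
proof -
  let ?B = "real CARD('n) * (C * (2 powr p * (1 + norm u) powr (- p)))"
  have "norm (\<phi> (u + h) - \<phi> u) \<le> ?B * norm (u + h - u)"
  proof (rule differentiable_bound[where S = "cball u (norm h)"])
    fix x assume x: "x \<in> cball u (norm h)"
    show "(\<phi> has_derivative frechet_derivative \<phi> (at x)) (at x within cball u (norm h))"
      using diff frechet_derivative_works has_derivative_at_withinI by blast
    have "norm u \<le> norm x + norm h"
      using x norm_triangle_ineq[of x "u - x"] by (simp add: dist_norm)
    then have "(1 + norm u) / 2 \<le> 1 + norm x" using h by (simp add: field_simps)
    then have "(1 + norm x) powr (- p) \<le> ((1 + norm u) / 2) powr (- p)"
      using \<open>0 \<le> p\<close> by (intro powr_mono2') (auto simp: add_pos_nonneg)
    also have "\<dots> = 2 powr p * (1 + norm u) powr (- p)"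
      by (simp add: powr_divide powr_minus field_simps)
    finally have "norm (gradient \<phi> x) \<le> C * (2 powr p * (1 + norm u) powr (- p))"
      using grad[of x] \<open>0 \<le> C\<close> by (meson mult_left_mono order_trans)
    then have "real CARD('n) * norm (gradient \<phi> x) \<le> ?B" by (intro mult_left_mono) auto
    then show "onorm (frechet_derivative \<phi> (at x)) \<le> ?B"
      by (intro onorm_le order_trans[OF norm_frechet_derivative_le_gradient[OF diff]] mult_right_mono) auto
  qed (auto simp: dist_norm)
  then show ?thesis by (simp add: mult.assoc mult.commute mult.left_commute)
qed

theorem theorem1p6:
  "(\<forall>\<phi> :: real^'n \<Rightarrow> complex^'m^'m.
      (\<exists>C>0. \<exists>\<epsilon>\<in>{0<..1}.
         (\<forall>x. x \<noteq> 0 \<longrightarrow> norm (\<phi> x) \<le> C * (1 + norm x) powr (- real CARD('n) - \<epsilon>)) \<and>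
         (\<forall>x h. x \<noteq> 0 \<longrightarrow> norm h < norm x / 2 \<longrightarrow>
            norm (\<phi> (x + h) - \<phi> x) \<le> C * norm h powr \<epsilon> / norm x powr (real CARD('n) + \<epsilon>))) \<longrightarrow>
      (LINT x|lebesgue. \<phi> x) = mat 1 \<longrightarrow>
      (\<forall>f \<in> (VMO :: (real^'n \<Rightarrow> complex^'m) set).
         tendsto_BMO (\<lambda>t. convolution (dilation t \<phi>) f) f (at_right 0)))
   \<and>
   (\<forall>\<phi> :: real^'n \<Rightarrow> complex^'m^'m.
      continuously_differentiable \<phi> \<longrightarrow>
      (LINT x|lebesgue. \<phi> x) = mat 1 \<longrightarrow>
      (\<exists>C>0. \<forall>x. norm (\<phi> x) + norm (gradient \<phi> x)
                   \<le> C * (1 + norm x) powr (- real CARD('n) - 1)) \<longrightarrow>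
      (\<forall>f \<in> (BMO :: (real^'n \<Rightarrow> complex^'m) set).
         tendsto_BMO (\<lambda>t. convolution (dilation t \<phi>) f) f (at_right 0) \<longleftrightarrow> f \<in> VMO))"
proof (intro conjI allI impI ballI)
  fix \<phi> :: "real^'n \<Rightarrow> complex^'m^'m" and f :: "real^'n \<Rightarrow> complex^'m"
  assume "\<exists>C>0. \<exists>\<epsilon>\<in>{0<..1}.
         (\<forall>x. x \<noteq> 0 \<longrightarrow> norm (\<phi> x) \<le> C * (1 + norm x) powr (- real CARD('n) - \<epsilon>)) \<and>
         (\<forall>x h. x \<noteq> 0 \<longrightarrow> norm h < norm x / 2 \<longrightarrow>
            norm (\<phi> (x + h) - \<phi> x) \<le> C * norm h powr \<epsilon> / norm x powr (real CARD('n) + \<epsilon>))"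
    and int: "(LINT x|lebesgue. \<phi> x) = mat 1" and f: "f \<in> VMO"
  then obtain C \<epsilon> where C: "0 < C" "0 < \<epsilon>"
    and decay: "\<And>x. x \<noteq> 0 \<Longrightarrow> norm (\<phi> x) \<le> C * (1 + norm x) powr (- real CARD('n) - \<epsilon>)"
    and hoelder: "\<And>x h. x \<noteq> 0 \<Longrightarrow> norm h < norm x / 2 \<Longrightarrow>
            norm (\<phi> (x + h) - \<phi> x) \<le> C * norm h powr \<epsilon> / norm x powr (real CARD('n) + \<epsilon>)"
    by auto
  interpret approximate_identity_kernel \<phi> C \<epsilon>
  proof unfold_locales
    show "continuous_on (- {0}) \<phi>"
      by (rule continuous_on_of_hoelder_off_0[OF C(2) hoelder])
  qed (rule C decay int | assumption)+
  show "tendsto_BMO (\<lambda>t. convolution (dilation t \<phi>) f) f (at_right 0)"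
    using f by (rule VMO_tendsto_BMO_convolution)
next
  fix \<phi> :: "real^'n \<Rightarrow> complex^'m^'m" and f :: "real^'n \<Rightarrow> complex^'m"
  assume c1: "continuously_differentiable \<phi>" and int: "(LINT x|lebesgue. \<phi> x) = mat 1"
    and "\<exists>C>0. \<forall>x. norm (\<phi> x) + norm (gradient \<phi> x) \<le> C * (1 + norm x) powr (- real CARD('n) - 1)"
    and f: "f \<in> BMO"
  then obtain C where "0 < C"
    and bound: "\<And>x. norm (\<phi> x) + norm (gradient \<phi> x) \<le> C * (1 + norm x) powr (- real CARD('n) - 1)"
    by auto
  have diff: "\<phi> differentiable (at x)" for x
    using c1 by (simp add: continuously_differentiable_def)
  have decay: "norm (\<phi> x) \<le> C * (1 + norm x) powr (- real CARD('n) - 1)" for x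
    using bound[of x] norm_ge_zero[of "gradient \<phi> x"] by linarith
  have grad: "norm (gradient \<phi> x) \<le> C * (1 + norm x) powr (- (real CARD('n) + 1))" for x
    using order_trans[OF _ bound[of x], of "norm (gradient \<phi> x)"] by simp
  have cont: "continuous_on (- {0}) \<phi>"
    using diff by (intro continuous_at_imp_continuous_on ballI differentiable_imp_continuous_within)
  \<comment> \<open>The C^1 kernel is an instance with \<open>\<epsilon> = 1\<close>; the gradient
    bound then enters through \<open>lip\<close>, with \<open>p = n + 1\<close>.\<close>
  interpret approximate_identity_kernel \<phi> C 1
    by unfold_locales (rule \<open>0 < C\<close> zero_less_one cont decay int)+
  let ?L = "real CARD('n) * C * 2 powr (real CARD('n) + 1)"
  have lip: "norm (\<phi> (u + h) - \<phi> u) \<le> ?L * norm h * (1 + norm u) powr (- real CARD('n) - 1)"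
    if "norm h \<le> (1 + norm u) / 2" for u h
    using increment_le_of_gradient_decay[OF diff grad _ _ that] \<open>0 < C\<close> by simp
  show "tendsto_BMO (\<lambda>t. convolution (dilation t \<phi>) f) f (at_right 0) \<longleftrightarrow> f \<in> VMO"
  proof
    assume "tendsto_BMO (\<lambda>t. convolution (dilation t \<phi>) f) f (at_right 0)"
    then show "f \<in> VMO"
      using \<open>0 < C\<close> by (intro VMO_if_tendsto_BMO_convolution[OF lip _ f]) auto
  qed (rule VMO_tendsto_BMO_convolution)
qed

end
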